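(* Let $0<\gamma<1$ be a quadratic irrational such that $1/\gamma$ has a purely periodic continued fraction expansion. Let $\alpha$ be an irrational real number and $\beta$ a real number, and suppose that the Beatty sequence $(\lfloor n\alpha+\beta\rfloor)_{n\ge 1}$ is $\gamma$-Ostrowski synchronized. Then $\alpha$ and $\beta$ both belong to $\mathbb{Q}(\gamma)$. Furthermore, the expression of both $\alpha$ and $\beta$ in terms of $\gamma$ (i.e., as rational linear combinations of $1$ and $\gamma$) is computable from a synchronizing automaton for the sequence.
   Context: A continued fraction is purely periodic if it has the form $[a_1,\ldots,a_P,a_1,\ldots,a_P,\ldots]$ for some $P\ge 1$. Let $0<\gamma<1$ be irrational with continued fraction $[a_0,a_1,a_2,\ldots]$, $a_0=0$. Define $p_i=a_ip_{i-1}+p_{i-2}$, $q_i=a_iq_{i-1}+q_{i-2}$ for $i\ge 0$, with $p_{-2}=q_{-1}=0$ and $q_{-2}=p_{-1}=1$. Every natural number $n$ (including $0$) can be written uniquely (up to leading zeros) as $n=\sum_{0\le i\le t}e_iq_i$ with integers $e_i$ satisfying: (a) $0\le e_i\le a_{i+1}$ for $i\ge 1$; (b) for $i\ge 1$, $e_i=a_{i+1}$ implies $e_{i-1}=0$; (c) $0\le e_0<a_1$. The word $(n)_\gamma=e_te_{t-1}\cdots e_0$ (most significant digit first, no leading zeros) is the Ostrowski $\gamma$-representation of $n$. A pair $(n,y)$ is represented as a word over pairs of digits by padding the shorter of $(n)_\gamma,(y)_\gamma$ with leading zeros to equal length and reading both in parallel. A sequence $(s_n)_{n\ge 1}$ of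 natural numbers is $\gamma$-Ostrowski synchronized if there is a finite automaton that, reading the Ostrowski $\gamma$-representations of $n\geq 1$ and of a natural number $y$ in parallel, accepts if and only if $y=s_n$; such an automaton is called a synchronizing automaton for the sequence. *)

theory Defs
  imports Complex_Main "HOL-Library.Nat_Bijection"
begin

section \<open>Continued fractions and quadratic irrationals\<close>

text \<open>Complete quotients and partial quotients of the (infinite) simple continued fraction of
  an irrational number; \<^term>\<open>x\<close> is only ever irrational below, so no division by zero occurs.\<close>

fun cf_rem :: "real \<Rightarrow> nat \<Rightarrow> real" where
  "cf_rem x 0 = x"
| "cf_rem x (Suc n) = 1 / frac (cf_rem x n)"

definition cf_coeff :: "real \<Rightarrow> nat \<Rightarrow> int" where
  "cf_coeff x n = \<lfloor>cf_rem x n\<rfloor>"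

definition purely_periodic_cf :: "real \<Rightarrow> bool" where
  "purely_periodic_cf x \<longleftrightarrow> (\<exists>P\<ge>1. \<forall>n. cf_coeff x (n + P) = cf_coeff x n)"

definition quadratic_irrational :: "real \<Rightarrow> bool" where
  "quadratic_irrational x \<longleftrightarrow>
     x \<notin> \<rat> \<and> (\<exists>a b c :: int. a \<noteq> 0 \<and> of_int a * x\<^sup>2 + of_int b * x + of_int c = 0)"

definition real_subfield :: "real set \<Rightarrow> bool" where
  "real_subfield K \<longleftrightarrow> 0 \<in> K \<and> 1 \<in> K \<and>
     (\<forall>x\<in>K. \<forall>y\<in>K. x + y \<in> K \<and> x - y \<in> K \<and> x * y \<in> K) \<and> (\<forall>x\<in>K. x \<noteq> 0 \<longrightarrow> inverse x \<in> K)"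

text \<open>The field extension of the rationals generated by \<^term>\<open>x\<close> inside the reals.\<close>

definition rat_adjoin :: "real \<Rightarrow> real set" where
  "rat_adjoin x = \<Inter>{K. real_subfield K \<and> x \<in> K}"

section \<open>Ostrowski representations\<close>

definition cf_digit :: "real \<Rightarrow> nat \<Rightarrow> nat" where
  "cf_digit \<gamma> i = nat (cf_coeff \<gamma> i)"

text \<open>Denominators of the convergents. The first two equations are the recurrence evaluated at
  the initial values \<open>q\<^sub>-\<^sub>2 = 1\<close> and \<open>q\<^sub>-\<^sub>1 = 0\<close>, using \<open>a\<^sub>0 = 0\<close>.\<close>

fun conv_denom :: "real \<Rightarrow> nat \<Rightarrow> nat" where
  "conv_denom \<gamma> 0 = 1"
| "conv_denom \<gamma> (Suc 0) = cf_digit \<gamma> 1"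
| "conv_denom \<gamma> (Suc (Suc i)) =
     cf_digit \<gamma> (Suc (Suc i)) * conv_denom \<gamma> (Suc i) + conv_denom \<gamma> i"

text \<open>Words are written most significant digit first, so the digit \<open>e\<^sub>i\<close> of \<^term>\<open>w\<close> is
  \<^term>\<open>rev w ! i\<close>. The number \<open>0\<close> is represented by the empty word.\<close>

definition is_ostrowski_rep :: "real \<Rightarrow> nat \<Rightarrow> nat list \<Rightarrow> bool" where
  "is_ostrowski_rep \<gamma> n w \<longleftrightarrow>
     (let e = (\<lambda>i. rev w ! i) in
       n = (\<Sum>i<length w. e i * conv_denom \<gamma> i) \<and>
       (\<forall>i. 1 \<le> i \<and> i < length w \<longrightarrow> e i \<le> cf_digit \<gamma> (i + 1)) \<and>
       (\<forall>i. 1 \<le> i \<and> i < length w \<longrightarrow> e i = cf_digit \<gamma> (i + 1) \<longrightarrow> e (i - 1) = 0) \<and>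
       (w \<noteq> [] \<longrightarrow> e 0 < cf_digit \<gamma> 1) \<and>
       (w \<noteq> [] \<longrightarrow> hd w \<noteq> 0))"

definition ostrowski_rep :: "real \<Rightarrow> nat \<Rightarrow> nat list" where
  "ostrowski_rep \<gamma> n = (THE w. is_ostrowski_rep \<gamma> n w)"

text \<open>Truncated subtraction means that only the shorter word is actually padded.\<close>

definition pad_zip :: "nat list \<Rightarrow> nat list \<Rightarrow> (nat \<times> nat) list" where
  "pad_zip u v = zip (replicate (length v - length u) 0 @ u) (replicate (length u - length v) 0 @ v)"

definition ostrowski_pair :: "real \<Rightarrow> nat \<Rightarrow> nat \<Rightarrow> (nat \<times> nat) list" where
  "ostrowski_pair \<gamma> n y = pad_zip (ostrowski_rep \<gamma> n) (ostrowski_rep \<gamma> y)"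

section \<open>Finite automata and synchronized sequences\<close>

text \<open>A finite automaton over pairs of digits, given as explicit finite data with states named by
  natural numbers: initial state, final states, and transitions (source, letter, target).
  Determinism is not demanded; deterministic automata are a special case.\<close>

datatype automaton = Automaton
  (initial: nat) (final: "nat list") (transitions: "(nat \<times> (nat \<times> nat) \<times> nat) list")

fun reaches :: "automaton \<Rightarrow> nat \<Rightarrow> (nat \<times> nat) list \<Rightarrow> nat \<Rightarrow> bool" where
  "reaches A p [] q \<longleftrightarrow> p = q"
| "reaches A p (c # w) q \<longleftrightarrow> (\<exists>r. (p, c, r) \<in> set (transitions A) \<and> reaches A r w q)"

definition accepts :: "automaton \<Rightarrow> (nat \<times> nat) list \<Rightarrow> bool" where
  "accepts A w \<longleftrightarrow> (\<exists>q\<in>set (final A). reaches A (initial A) w q)"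

text \<open>Sequences are indexed from 1, so the value at index 0 is irrelevant. Nonnegativity expresses
  that the integer-valued sequence is a sequence of natural numbers. The automaton is unconstrained
  on words that are not (padded) Ostrowski representations.\<close>

definition synchronizes :: "real \<Rightarrow> automaton \<Rightarrow> (nat \<Rightarrow> int) \<Rightarrow> bool" where
  "synchronizes \<gamma> A s \<longleftrightarrow>
     (\<forall>n\<ge>1. 0 \<le> s n) \<and>
     (\<forall>n\<ge>1. \<forall>y. accepts A (ostrowski_pair \<gamma> n y) \<longleftrightarrow> int y = s n)"

definition ostrowski_synchronized :: "real \<Rightarrow> (nat \<Rightarrow> int) \<Rightarrow> bool" where
  "ostrowski_synchronized \<gamma> s \<longleftrightarrow> (\<exists>A. synchronizes \<gamma> A s)"

definition beatty :: "real \<Rightarrow> real \<Rightarrow> nat \<Rightarrow> int" where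
  "beatty \<alpha> \<beta> n = \<lfloor>real n * \<alpha> + \<beta>\<rfloor>"

section \<open>Computability\<close>

text \<open>Kleene's partial recursive functions: \<open>reval f xs y\<close> means that the program \<open>f\<close> halts on the
  arguments \<open>xs\<close> with value \<open>y\<close>. Minimization searches in the first argument.\<close>

datatype recf = Zero | Succ | Proj nat | Comp recf "recf list" | Prec recf recf | Mu recf

inductive reval :: "recf \<Rightarrow> nat list \<Rightarrow> nat \<Rightarrow> bool" where
  zero: "reval Zero xs 0"
| succ: "reval Succ [x] (Suc x)"
| proj: "i < length xs \<Longrightarrow> reval (Proj i) xs (xs ! i)"
| comp: "list_all2 (\<lambda>g y. reval g xs y) gs ys \<Longrightarrow> reval f ys z \<Longrightarrow> reval (Comp f gs) xs z"
| prec_0: "reval f xs y \<Longrightarrow> reval (Prec f g) (0 # xs) y"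
| prec_Suc: "reval (Prec f g) (n # xs) y \<Longrightarrow> reval g (n # y # xs) z \<Longrightarrow>
    reval (Prec f g) (Suc n # xs) z"
| mu: "reval f (n # xs) 0 \<Longrightarrow> (\<forall>m<n. \<exists>k. reval f (m # xs) (Suc k)) \<Longrightarrow> reval (Mu f) xs n"

definition partial_recursive :: "(nat \<Rightarrow> nat option) \<Rightarrow> bool" where
  "partial_recursive F \<longleftrightarrow> (\<exists>f. \<forall>x y. F x = Some y \<longleftrightarrow> reval f [x] y)"

definition transition_code :: "nat \<times> (nat \<times> nat) \<times> nat \<Rightarrow> nat" where
  "transition_code = (\<lambda>(p, c, q). prod_encode (p, prod_encode (prod_encode c, q)))"

definition automaton_code :: "automaton \<Rightarrow> nat" where
  "automaton_code A =
     prod_encode (initial A, prod_encode (list_encode (final A),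
       list_encode (map transition_code (transitions A))))"

text \<open>A natural number read as a (not necessarily reduced) fraction of an integer and a natural
  number; every rational number has a code.\<close>

definition rat_decode :: "nat \<Rightarrow> rat" where
  "rat_decode c = (case prod_decode c of (a, b) \<Rightarrow> of_int (int_decode a) / of_nat b)"

text \<open>A natural number read as a pair of rationals \<open>(r, s)\<close> standing for \<open>r + s * \<gamma>\<close>.\<close>

definition lin_comb_decode :: "real \<Rightarrow> nat \<Rightarrow> real" where
  "lin_comb_decode \<gamma> c =
     (case prod_decode c of (r, s) \<Rightarrow> of_rat (rat_decode r) + of_rat (rat_decode s) * \<gamma>)"

end

theory Submission
  imports Defs "HOL-Analysis.Kronecker_Approximation_Theorem"
begin

text \<open>Let \<open>s\<^sub>n = \<lfloor>n \<alpha> + \<beta>\<rfloor>\<close> and \<open>w n = s\<^sub>n - n \<alpha>\<close>, so that \<open>\<beta> - 1 < w n \<le> \<beta>\<close>. A loop in an accepting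
  run whose length \<open>b\<close> is a multiple of the period can be pumped, and since \<open>q\<^sub>i\<^sub>+\<^sub>2\<^sub>b - T q\<^sub>i\<^sub>+\<^sub>b + q\<^sub>i = 0\<close>
  with \<open>T = \<mu> + 1 / \<mu>\<close> and \<open>0 < \<mu> < 1 / 2\<close>, the values of \<open>w\<close> along the pumped runs satisfy
  \<open>w\<^sub>k\<^sub>+\<^sub>2 - T w\<^sub>k\<^sub>+\<^sub>1 + w\<^sub>k = C\<close>. Boundedness forces \<open>w\<^sub>k - c = \<mu>\<^sup>k (w\<^sub>0 - c)\<close> with \<open>c = C / (2 - T)\<close>, which
  yields \<open>\<alpha>\<close> in terms of \<open>\<mu>\<close>, that is, of \<open>\<gamma>\<close>. The constant \<open>c\<close> depends only on the digits up to the end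
  of the loop, so it takes finitely many values when the loops stay in a bounded window of low
  positions. Choosing \<open>n\<close> with \<open>w n\<close> close to \<open>\<beta>\<close> makes \<open>c\<close> close to \<open>\<beta>\<close> (comparing also with the run
  without the loop), hence some loop has \<open>c = \<beta>\<close>; likewise some loop has \<open>c = \<beta> - 1\<close>. Conversely, any
  two loops with limits \<open>v\<close> and \<open>v - 1\<close> force \<open>v = \<beta>\<close>, as all limits lie in \<open>[\<beta> - 1, \<beta>]\<close>. Such a pair of
  loops is thus a finite certificate that can be found by unbounded search.\<close>

section \<open>Recursive functions\<close>

text \<open>Lets a program be read as a partial function in the search below. In the minimization
  case, the smaller of two distinct results would have to give both 0 and a successor.\<close>

lemma reval_deterministic: "reval f xs y \<Longrightarrow> reval f xs z \<Longrightarrow> y = z"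
proof (induction arbitrary: z rule: reval.induct)
  case (zero xs)
  then show ?case by (cases rule: reval.cases) auto
next
  case (succ x)
  then show ?case by (cases rule: reval.cases) auto
next
  case (proj i xs)
  from proj.prems show ?case by (cases rule: reval.cases) auto
next
  case (comp xs gs ys f w)
  from comp.prems obtain ys' where ys': "list_all2 (\<lambda>g y. reval g xs y) gs ys'" "reval f ys' z"
    by (cases rule: reval.cases) auto
  have "ys = ys'"
    using comp.IH(1) ys'(1) by (auto simp: list_all2_conv_all_nth intro!: nth_equalityI)
  then show ?case using comp.IH(2) ys'(2) by blast
next
  case (prec_0 f xs y g)
  from prec_0.prems have "reval f xs z" by (cases rule: reval.cases) auto
  then show ?case using prec_0.IH by blast
next
  case (prec_Suc f g n xs y w)
  from prec_Suc.prems obtain y' where "reval (Prec f g) (n # xs) y'" "reval g (n # y' # xs) z"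
    by (cases rule: reval.cases) auto
  then show ?case using prec_Suc.IH by blast
next
  case (mu f n xs)
  from mu.prems have z: "reval f (z # xs) 0" "\<forall>m<z. \<exists>k. reval f (m # xs) (Suc k)"
    by (cases rule: reval.cases; auto)+
  show ?case
  proof (cases n z rule: linorder_cases)
    case less
    then obtain k where "reval f (n # xs) (Suc k)" using z by blast
    then show ?thesis using mu.IH by fastforce
  next
    case greater
    then show ?thesis using mu.IH z by fastforce
  qed
qed

section \<open>Total recursive functions of fixed arity\<close>

definition total_recursive :: "nat \<Rightarrow> (nat list \<Rightarrow> nat) \<Rightarrow> bool" where
  "total_recursive n f \<longleftrightarrow> (\<exists>p. \<forall>xs. length xs = n \<longrightarrow> reval p xs (f xs))"

lemma total_recursive_proj: "i < n \<Longrightarrow> total_recursive n (\<lambda>xs. xs ! i)"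
  unfolding total_recursive_def by (metis reval.proj)

lemma total_recursive_comp:
  assumes "total_recursive (length fs) h" "\<forall>f\<in>set fs. total_recursive n f"
  shows "total_recursive n (\<lambda>xs. h (map (\<lambda>f. f xs) fs))"
proof -
  obtain p where p: "\<And>ys. length ys = length fs \<Longrightarrow> reval p ys (h ys)"
    using assms(1) unfolding total_recursive_def by blast
  obtain P where P: "\<And>f xs. f \<in> set fs \<Longrightarrow> length xs = n \<Longrightarrow> reval (P f) xs (f xs)"
    using assms(2) unfolding total_recursive_def by metis
  have "reval (Comp p (map P fs)) xs (h (map (\<lambda>f. f xs) fs))" if "length xs = n" for xs
    by (rule reval.comp[OF _ p]) (auto simp: list_all2_conv_all_nth P that)
  then show ?thesis unfolding total_recursive_def by blast
qed

lemma total_recursive_Suc: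
  assumes "total_recursive n f" shows "total_recursive n (\<lambda>xs. Suc (f xs))"
proof -
  have "total_recursive 1 (\<lambda>xs. Suc (xs ! 0))"
    unfolding total_recursive_def by (intro exI[of _ Succ]) (auto simp: length_Suc_conv intro: reval.succ)
  then show ?thesis using total_recursive_comp[of "[f]" "\<lambda>xs. Suc (xs ! 0)"] assms by simp
qed

lemma total_recursive_const: "total_recursive n (\<lambda>_. k)"
proof (induction k)
  case 0
  then show ?case unfolding total_recursive_def using reval.zero by blast
qed (rule total_recursive_Suc)

lemma total_recursive_comp1:
  "total_recursive 1 (\<lambda>ys. h (ys ! 0)) \<Longrightarrow> total_recursive n f \<Longrightarrow> total_recursive n (\<lambda>xs. h (f xs))"
  using total_recursive_comp[of "[f]" "\<lambda>ys. h (ys ! 0)"] by simp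

lemma total_recursive_comp2:
  "total_recursive 2 (\<lambda>ys. h (ys ! 0) (ys ! 1)) \<Longrightarrow> total_recursive n f \<Longrightarrow> total_recursive n g \<Longrightarrow>
    total_recursive n (\<lambda>xs. h (f xs) (g xs))"
  using total_recursive_comp[of "[f, g]" "\<lambda>ys. h (ys ! 0) (ys ! 1)"]
  by (simp add: numeral_2_eq_2)

lemma total_recursive_prec:
  assumes "total_recursive n b" "total_recursive (Suc (Suc n)) (\<lambda>ys. g (ys ! 0) (ys ! 1) (drop 2 ys))"
  shows "total_recursive (Suc n) (\<lambda>xs. rec_nat (b (tl xs)) (\<lambda>m r. g m r (tl xs)) (xs ! 0))"
proof -
  obtain p q where p: "\<And>xs. length xs = n \<Longrightarrow> reval p xs (b xs)"
    and q: "\<And>xs. length xs = Suc (Suc n) \<Longrightarrow> reval q xs (g (xs ! 0) (xs ! 1) (drop 2 xs))"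
    using assms unfolding total_recursive_def by auto
  have *: "reval (Prec p q) (k # xs) (rec_nat (b xs) (\<lambda>m r. g m r xs) k)"
    if "length xs = n" for k xs
  proof (induction k)
    case 0
    then show ?case using reval.prec_0[OF p[OF that]] by simp
  next
    case (Suc k)
    then show ?case
      using reval.prec_Suc[OF Suc q[of "k # rec_nat (b xs) (\<lambda>m r. g m r xs) k # xs"]] that by simp
  qed
  show ?thesis unfolding total_recursive_def
    by (intro exI[of _ "Prec p q"]) (auto simp: length_Suc_conv *)
qed

lemma total_recursive_cong:
  "total_recursive n f \<Longrightarrow> (\<And>xs. length xs = n \<Longrightarrow> f xs = g xs) \<Longrightarrow> total_recursive n g"
  unfolding total_recursive_def by metis

lemma total_recursive_prec_unary:
  assumes "total_recursive 2 (\<lambda>ys. g (ys ! 0) (ys ! 1))"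
  shows "total_recursive 1 (\<lambda>xs. rec_nat c g (xs ! 0))"
  using total_recursive_prec[OF total_recursive_const[of 0 c], of "\<lambda>m r xs. g m r"] assms
  by (simp add: numeral_2_eq_2)

lemma total_recursive_prec_binary:
  assumes "total_recursive 1 (\<lambda>xs. b (xs ! 0))" "total_recursive 3 (\<lambda>ys. g (ys ! 2) (ys ! 0) (ys ! 1))"
  shows "total_recursive 2 (\<lambda>xs. rec_nat (b (xs ! 1)) (g (xs ! 1)) (xs ! 0))"
proof -
  have "total_recursive (Suc (Suc 1)) (\<lambda>ys. g (drop 2 ys ! 0) (ys ! 0) (ys ! 1))"
    using assms(2) by (auto intro: total_recursive_cong simp: numeral_3_eq_3)
  from total_recursive_prec[OF assms(1) this]
  have "total_recursive 2 (\<lambda>xs. rec_nat (b (tl xs ! 0)) (g (tl xs ! 0)) (xs ! 0))"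
    by (simp add: numeral_2_eq_2)
  then show ?thesis by (rule total_recursive_cong) (auto simp: nth_tl)
qed

lemma total_recursive_add:
  assumes "total_recursive n f" "total_recursive n g"
  shows "total_recursive n (\<lambda>xs. f xs + g xs)"
proof -
  have "total_recursive 2 (\<lambda>xs. rec_nat (xs ! 1) (\<lambda>m r. Suc r) (xs ! 0))"
    by (rule total_recursive_prec_binary[where b = "\<lambda>y. y" and g = "\<lambda>y m r. Suc r"];
        intro total_recursive_Suc total_recursive_proj) simp_all
  moreover have "rec_nat y (\<lambda>m r. Suc r) k = k + y" for y k by (induction k) auto
  ultimately show ?thesis using total_recursive_comp2[of "(+)"] assms by simp
qed

lemma total_recursive_mult:
  assumes "total_recursive n f" "total_recursive n g"
  shows "total_recursive n (\<lambda>xs. f xs * g xs)"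
proof -
  have "total_recursive 2 (\<lambda>xs. rec_nat 0 (\<lambda>m r. xs ! 1 + r) (xs ! 0))"
    by (rule total_recursive_prec_binary[where b = "\<lambda>y. 0" and g = "\<lambda>y m r. y + r"];
        intro total_recursive_add total_recursive_proj total_recursive_const) simp_all
  moreover have "rec_nat 0 (\<lambda>m r. y + r) k = k * y" for y k :: nat by (induction k) auto
  ultimately show ?thesis using total_recursive_comp2[of "(*)"] assms by simp
qed

lemma total_recursive_pred:
  assumes "total_recursive n f"
  shows "total_recursive n (\<lambda>xs. f xs - 1)"
proof -
  have "total_recursive 1 (\<lambda>xs. rec_nat 0 (\<lambda>m r. m) (xs ! 0))"
    by (rule total_recursive_prec_unary, rule total_recursive_proj) simp
  moreover have "rec_nat 0 (\<lambda>m r. m) k = k - 1" for k :: nat by (cases k) auto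
  ultimately show ?thesis using total_recursive_comp1[of "\<lambda>k. k - 1" n f] assms by simp
qed

lemma total_recursive_diff:
  assumes "total_recursive n f" "total_recursive n g"
  shows "total_recursive n (\<lambda>xs. f xs - g xs)"
proof -
  have "total_recursive 2 (\<lambda>xs. rec_nat (xs ! 1) (\<lambda>m r. r - 1) (xs ! 0))"
    by (rule total_recursive_prec_binary[where b = "\<lambda>y. y" and g = "\<lambda>y m r. r - 1"];
        intro total_recursive_pred total_recursive_proj) simp_all
  moreover have "rec_nat y (\<lambda>m r. r - 1) k = y - k" for y k :: nat by (induction k) auto
  ultimately show ?thesis using total_recursive_comp2[of "\<lambda>k y. y - k" n g f] assms by simp
qed

section \<open>Inversion of the pairing function\<close>

lemma total_recursive_triangle:
  assumes "total_recursive n f"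
  shows "total_recursive n (\<lambda>xs. triangle (f xs))"
proof -
  have "total_recursive 1 (\<lambda>xs. rec_nat 0 (\<lambda>m r. r + Suc m) (xs ! 0))"
    by (rule total_recursive_prec_unary;
        intro total_recursive_add total_recursive_Suc total_recursive_proj) simp_all
  moreover have "rec_nat 0 (\<lambda>m r. r + Suc m) k = triangle k" for k :: nat by (induction k) auto
  ultimately show ?thesis using total_recursive_comp1[of triangle n f] assms by simp
qed

lemma total_recursive_prod_encode:
  assumes "total_recursive n f" "total_recursive n g"
  shows "total_recursive n (\<lambda>xs. prod_encode (f xs, g xs))"
  unfolding prod_encode_def using assms
  by (auto intro!: total_recursive_add total_recursive_triangle)

text \<open>The largest \<open>r\<close> with \<open>triangle r \<le> z\<close>, that is, the
  diagonal of \<open>z\<close> under the pairing. The truncated subtraction adds 1 exactly when the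
  next triangular number has been reached.\<close>

definition triangle_root :: "nat \<Rightarrow> nat" where
  "triangle_root = rec_nat 0 (\<lambda>m r. r + (1 - (triangle (Suc r) - Suc m)))"

lemma triangle_root: "triangle (triangle_root z) \<le> z \<and> z < triangle (Suc (triangle_root z))"
proof (induction z)
  case (Suc z)
  have s: "triangle_root (Suc z) =
      triangle_root z + (1 - (triangle (Suc (triangle_root z)) - Suc z))"
    by (simp add: triangle_root_def)
  show ?case
  proof (cases "triangle (Suc (triangle_root z)) \<le> Suc z")
    case True
    then have e: "triangle_root (Suc z) = Suc (triangle_root z)" using s by simp
    show ?thesis using Suc True unfolding e by simp
  next
    case False
    then have e: "triangle_root (Suc z) = triangle_root z" using s by simp
    show ?thesis using Suc False unfolding e by simp
  qed
qed (simp add: triangle_root_def)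

definition pfst :: "nat \<Rightarrow> nat" where "pfst z = fst (prod_decode z)"
definition psnd :: "nat \<Rightarrow> nat" where "psnd z = snd (prod_decode z)"

lemma pfst_prod_encode [simp]: "pfst (prod_encode (a, b)) = a"
  and psnd_prod_encode [simp]: "psnd (prod_encode (a, b)) = b"
  by (simp_all add: pfst_def psnd_def)

text \<open>Since \<open>prod_encode (a, b) = triangle (a + b) + a\<close>, the diagonal
  \<open>a + b\<close> is \<open>triangle_root z\<close>. These closed forms make both projections
  recursive.\<close>

lemma prod_decode_triangle_root:
  "pfst z = z - triangle (triangle_root z)"
  "psnd z = triangle_root z - (z - triangle (triangle_root z))"
proof -
  let ?t = "triangle_root z"
  have "z - triangle ?t \<le> ?t" using triangle_root[of z] by (auto simp: le_diff_conv add.commute)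
  then have "prod_encode (z - triangle ?t, ?t - (z - triangle ?t)) = z"
    using triangle_root[of z] by (simp add: prod_encode_def)
  then show "pfst z = z - triangle ?t" "psnd z = ?t - (z - triangle ?t)"
    by (metis pfst_prod_encode, metis psnd_prod_encode)
qed

section \<open>Unary recursive functions and decidable predicates\<close>

definition recursive :: "(nat \<Rightarrow> nat) \<Rightarrow> bool" where
  "recursive f \<longleftrightarrow> total_recursive 1 (\<lambda>xs. f (xs ! 0))"

named_theorems recursive_intros

lemma recursive_id [recursive_intros]: "recursive (\<lambda>x. x)"
  unfolding recursive_def by (simp add: total_recursive_proj)

lemma recursive_const [recursive_intros]: "recursive (\<lambda>_. k)"
  unfolding recursive_def by (rule total_recursive_const)

lemma recursive_comp: "recursive g \<Longrightarrow> recursive f \<Longrightarrow> recursive (\<lambda>x. g (f x))"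
  unfolding recursive_def by (rule total_recursive_comp1)

lemma recursive_Suc [recursive_intros]: "recursive f \<Longrightarrow> recursive (\<lambda>x. Suc (f x))"
  unfolding recursive_def by (rule total_recursive_Suc)

lemma recursive_add [recursive_intros]:
  "recursive f \<Longrightarrow> recursive g \<Longrightarrow> recursive (\<lambda>x. f x + g x)"
  unfolding recursive_def by (rule total_recursive_add)

lemma recursive_mult [recursive_intros]:
  "recursive f \<Longrightarrow> recursive g \<Longrightarrow> recursive (\<lambda>x. f x * g x)"
  unfolding recursive_def by (rule total_recursive_mult)

lemma recursive_diff [recursive_intros]:
  "recursive f \<Longrightarrow> recursive g \<Longrightarrow> recursive (\<lambda>x. f x - g x)"
  unfolding recursive_def by (rule total_recursive_diff)

lemma recursive_prod_encode [recursive_intros]: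
  "recursive f \<Longrightarrow> recursive g \<Longrightarrow> recursive (\<lambda>x. prod_encode (f x, g x))"
  unfolding recursive_def by (rule total_recursive_prod_encode)

lemma recursive_triangle_root: "recursive triangle_root"
proof -
  have "total_recursive 1
      (\<lambda>xs. rec_nat 0 (\<lambda>m r. r + (1 - (triangle (Suc r) - Suc m))) (xs ! 0))"
    by (rule total_recursive_prec_unary;
        intro total_recursive_add total_recursive_diff total_recursive_const
          total_recursive_triangle total_recursive_Suc total_recursive_proj) simp_all
  then show ?thesis by (simp add: recursive_def triangle_root_def)
qed

lemma recursive_pfst [recursive_intros]: "recursive f \<Longrightarrow> recursive (\<lambda>x. pfst (f x))"
  and recursive_psnd [recursive_intros]: "recursive f \<Longrightarrow> recursive (\<lambda>x. psnd (f x))"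
proof -
  have t: "recursive triangle" unfolding recursive_def
    by (intro total_recursive_triangle total_recursive_proj) simp
  note r = recursive_triangle_root recursive_comp[OF t recursive_triangle_root]
  have "recursive pfst" "recursive psnd"
    unfolding prod_decode_triangle_root[abs_def] by (intro recursive_intros r)+
  then show "recursive f \<Longrightarrow> recursive (\<lambda>x. pfst (f x))" "recursive f \<Longrightarrow> recursive (\<lambda>x. psnd (f x))"
    by (auto intro: recursive_comp)
qed

text \<open>Functions of several arguments are handled by packing the whole environment, including the
  recursion variable and the accumulator, into one number.\<close>

lemma recursive_rec_nat [recursive_intros]:
  assumes "recursive n" "recursive b" "recursive (\<lambda>e. g (pfst e) (pfst (psnd e)) (psnd (psnd e)))"
  shows "recursive (\<lambda>x. rec_nat (b x) (g x) (n x))"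
proof -
  have "total_recursive 3 (\<lambda>ys. g (ys ! 2) (ys ! 0) (ys ! 1))"
    using total_recursive_comp1[OF assms(3)[unfolded recursive_def], of 3
        "\<lambda>ys. prod_encode (ys ! 2, prod_encode (ys ! 0, ys ! 1))"]
    by (simp add: total_recursive_prod_encode total_recursive_proj)
  from total_recursive_prec_binary[OF assms(2)[unfolded recursive_def] this]
  show ?thesis
    unfolding recursive_def
    by (rule total_recursive_comp2[where h = "\<lambda>k x. rec_nat (b x) (g x) k"])
      (use assms(1) in \<open>auto simp: recursive_def intro: total_recursive_proj\<close>)
qed

definition decidable :: "(nat \<Rightarrow> bool) \<Rightarrow> bool" where
  "decidable P \<longleftrightarrow> recursive (\<lambda>x. of_bool (P x))"

lemma recursive_of_bool [recursive_intros]: "decidable P \<Longrightarrow> recursive (\<lambda>x. of_bool (P x))"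
  by (simp add: decidable_def)

lemma decidable_le [recursive_intros]:
  assumes "recursive f" "recursive g" shows "decidable (\<lambda>x. f x \<le> g x)"
proof -
  have "(\<lambda>x. of_bool (f x \<le> g x)) = (\<lambda>x. 1 - (f x - g x))" by auto
  then show ?thesis unfolding decidable_def using assms by (auto intro!: recursive_intros simp del: One_nat_def)
qed

lemma decidable_conj [recursive_intros]:
  "decidable P \<Longrightarrow> decidable Q \<Longrightarrow> decidable (\<lambda>x. P x \<and> Q x)"
  unfolding decidable_def of_bool_conj by (rule recursive_mult)

lemma decidable_not [recursive_intros]:
  assumes "decidable P" shows "decidable (\<lambda>x. \<not> P x)"
proof -
  have "(\<lambda>x. of_bool (\<not> P x)) = (\<lambda>x. 1 - of_bool (P x) :: nat)" by auto
  then show ?thesis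
    using recursive_diff[OF recursive_const[of 1] assms[unfolded decidable_def]]
    by (simp only: decidable_def)
qed

lemma decidable_disj [recursive_intros]:
  "decidable P \<Longrightarrow> decidable Q \<Longrightarrow> decidable (\<lambda>x. P x \<or> Q x)"
  using decidable_not[OF decidable_conj[OF decidable_not[of P] decidable_not[of Q]]] by simp

lemma decidable_imp [recursive_intros]:
  "decidable P \<Longrightarrow> decidable Q \<Longrightarrow> decidable (\<lambda>x. P x \<longrightarrow> Q x)"
  unfolding imp_conv_disj by (intro recursive_intros)

lemma decidable_eq [recursive_intros]:
  "recursive f \<Longrightarrow> recursive g \<Longrightarrow> decidable (\<lambda>x. f x = g x)"
  unfolding eq_iff by (intro recursive_intros)

lemma decidable_less [recursive_intros]:
  "recursive f \<Longrightarrow> recursive g \<Longrightarrow> decidable (\<lambda>x. f x < g x)"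
  unfolding less_le_not_le by (intro recursive_intros)

lemma recursive_if [recursive_intros]:
  assumes "decidable P" "recursive f" "recursive g"
  shows "recursive (\<lambda>x. if P x then f x else g x)"
proof -
  have "(\<lambda>x. if P x then f x else g x) = (\<lambda>x. of_bool (P x) * f x + of_bool (\<not> P x) * g x)" by auto
  then show ?thesis using assms by (auto intro!: recursive_intros simp del: of_bool_not_iff)
qed

lemma decidable_all [recursive_intros]:
  assumes "recursive n" "decidable (\<lambda>e. P (pfst e) (psnd e))"
  shows "decidable (\<lambda>x. \<forall>i<n x. P x i)"
proof -
  have *: "of_bool (\<forall>i<k. P x i) = rec_nat (1::nat) (\<lambda>i r. r * of_bool (P x i)) k" for x and k :: nat
  proof (induction k)
    case (Suc k)
    have "(\<forall>i<Suc k. P x i) \<longleftrightarrow> (\<forall>i<k. P x i) \<and> P x k" by (auto simp: less_Suc_eq)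
    then show ?case using Suc by (simp only: of_bool_conj old.nat.simps)
  qed simp
  \<comment> \<open>The recursion supplies the environment \<open>(x, (i, r))\<close>, of which the
    predicate ignores the accumulator \<open>r\<close>.\<close>
  have "decidable (\<lambda>e. P (pfst e) (pfst (psnd e)))"
    using recursive_comp[OF assms(2)[unfolded decidable_def],
        of "\<lambda>e. prod_encode (pfst e, pfst (psnd e))"]
    by (simp add: decidable_def recursive_intros)
  then show ?thesis unfolding decidable_def[of "\<lambda>x. \<forall>i<n x. P x i"] *
    using assms(1) by (intro recursive_intros)
qed

lemma decidable_ex [recursive_intros]:
  assumes "recursive n" "decidable (\<lambda>e. P (pfst e) (psnd e))"
  shows "decidable (\<lambda>x. \<exists>i<n x. P x i)"
  using decidable_not[OF decidable_all[OF assms(1) decidable_not[OF assms(2)]]] by simp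

lemma recursive_sum [recursive_intros]:
  assumes "recursive n" "recursive (\<lambda>e. f (pfst e) (psnd e))"
  shows "recursive (\<lambda>x. \<Sum>i<n x. f x i)"
proof -
  have *: "(\<Sum>i<k. f x i) = rec_nat 0 (\<lambda>i r. r + f x i) k" for x and k :: nat
    by (induction k) auto
  have "recursive (\<lambda>e. f (pfst e) (pfst (psnd e)))"
    using recursive_comp[OF assms(2), of "\<lambda>e. prod_encode (pfst e, pfst (psnd e))"]
    by (simp add: recursive_intros)
  then show ?thesis unfolding * using assms(1) by (intro recursive_intros)
qed

text \<open>The values on one period are finitely many constants that can be built into the program,
  however \<open>h\<close> was obtained. This is what makes the partial quotients of \<gamma>
  recursive.\<close>

lemma recursive_periodic:
  assumes "recursive f" "P > 0" and per: "\<And>i. h (i + P) = h i"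
  shows "recursive (\<lambda>x. h (f x))"
proof -
  have "rec_nat 0 (\<lambda>_ r. if Suc r = P then 0 else Suc r) k = k mod P" for k
    by (induction k) (use \<open>P > 0\<close> in \<open>auto simp: mod_Suc\<close>)
  moreover have "recursive (\<lambda>x. rec_nat 0 (\<lambda>_ r. if Suc r = P then 0 else Suc r) (f x))"
    using assms(1) by (intro recursive_intros)
  ultimately have md: "recursive (\<lambda>x. f x mod P)" by simp
  \<comment> \<open>A finite case distinction written as a sum. The induction runs over
    \<open>n\<close> outside the program, so every \<open>h j\<close> is a constant.\<close>
  have fin: "recursive (\<lambda>x. \<Sum>j<n. of_bool (f x mod P = j) * h j)" for n
    by (induction n) (auto intro!: recursive_intros md)
  have "h i = h (i mod P)" for i
  proof -
    have "h (j + k * P) = h j" for j k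
    proof (induction k)
      case (Suc k)
      then show ?case using per[of "j + k * P"] by (simp add: algebra_simps)
    qed simp
    from this[of "i mod P" "i div P"] show ?thesis by simp
  qed
  moreover have "(\<Sum>j<P. of_bool (f x mod P = j) * h j) = h (f x mod P)" for x
  proof -
    have "(\<Sum>j<P. of_bool (f x mod P = j) * h j) = (\<Sum>j<P. if f x mod P = j then h j else 0)"
      by (intro sum.cong) auto
    then show ?thesis using \<open>P > 0\<close> by simp
  qed
  ultimately show ?thesis using fin[of P] by (simp only:)
qed

lemma decidable_dvd_const [recursive_intros]:
  assumes "recursive f" "P > 0"
  shows "decidable (\<lambda>x. P dvd f x)"
  unfolding decidable_def
  by (rule recursive_periodic[OF assms, of "\<lambda>i. of_bool (P dvd i)"]) simp

section \<open>Access to coded lists\<close>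

definition list_drop :: "nat \<Rightarrow> nat \<Rightarrow> nat" where
  "list_drop c k = rec_nat c (\<lambda>_ r. psnd (r - 1)) k"

definition list_nth :: "nat \<Rightarrow> nat \<Rightarrow> nat" where
  "list_nth c k = pfst (list_drop c k - 1)"

lemma recursive_list_drop [recursive_intros]:
  assumes "recursive f" "recursive g" shows "recursive (\<lambda>x. list_drop (f x) (g x))"
proof -
  have "recursive (\<lambda>x. list_drop (pfst x) (psnd x))"
    unfolding list_drop_def by (intro recursive_intros)
  from recursive_comp[OF this, of "\<lambda>x. prod_encode (f x, g x)"] assms show ?thesis
    by (simp add: recursive_intros)
qed

lemma recursive_list_nth [recursive_intros]:
  "recursive f \<Longrightarrow> recursive g \<Longrightarrow> recursive (\<lambda>x. list_nth (f x) (g x))"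
  unfolding list_nth_def by (intro recursive_intros)

lemma list_drop_encode: "list_drop (list_encode xs) k = list_encode (drop k xs)"
proof (induction k)
  case 0
  then show ?case by (simp add: list_drop_def)
next
  case (Suc k)
  have "list_drop (list_encode xs) (Suc k) = psnd (list_encode (drop k xs) - 1)"
    using Suc by (simp add: list_drop_def)
  also have "\<dots> = list_encode (drop (Suc k) xs)"
  proof (cases "drop k xs")
    case Nil
    then have "drop (Suc k) xs = []" by simp
    \<comment> \<open>The empty list is coded by 0, so 0 has to be its own tail.\<close>
    have "psnd 0 = 0" using prod_decode_triangle_root(2)[of 0] by (simp add: triangle_root_def)
    then show ?thesis using Nil \<open>drop (Suc k) xs = []\<close> by simp
  next
    case (Cons y ys)
    then have "drop (Suc k) xs = ys" by (metis drop_Suc drop_tl list.sel(3))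
    then show ?thesis using Cons by simp
  qed
  finally show ?case .
qed

lemma list_nth_encode: "k < length xs \<Longrightarrow> list_nth (list_encode xs) k = xs ! k"
  by (simp add: list_nth_def list_drop_encode Cons_nth_drop_Suc[symmetric])

lemma length_le_list_encode: "length xs \<le> list_encode xs"
proof (induction xs)
  case (Cons x xs)
  then show ?case using le_prod_encode_2[of "list_encode xs" x] by (simp del: le_prod_encode_2)
qed simp

text \<open>The code bounds the number of positions by \<open>length_le_list_encode\<close>, so the
  search is bounded; \<open>list_drop c k \<noteq> 0\<close> says that position \<open>k\<close>
  lies inside the list.\<close>

definition list_mem :: "nat \<Rightarrow> nat \<Rightarrow> bool" where
  "list_mem c x \<longleftrightarrow> (\<exists>k<c. list_drop c k \<noteq> 0 \<and> list_nth c k = x)"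

lemma list_mem_encode: "list_mem (list_encode xs) x \<longleftrightarrow> x \<in> set xs"
proof
  assume "list_mem (list_encode xs) x"
  then obtain k where k: "list_encode (drop k xs) \<noteq> 0" "list_nth (list_encode xs) k = x"
    unfolding list_mem_def list_drop_encode by blast
  then have "k < length xs" by (cases "k < length xs") auto
  then show "x \<in> set xs" using k list_nth_encode by auto
next
  assume "x \<in> set xs"
  then obtain k where k: "k < length xs" "xs ! k = x" by (auto simp: in_set_conv_nth)
  moreover from k have "list_encode (drop k xs) \<noteq> 0" by (simp add: Cons_nth_drop_Suc[symmetric])
  ultimately show "list_mem (list_encode xs) x"
    unfolding list_mem_def list_drop_encode
    using list_nth_encode[of k xs] length_le_list_encode[of xs] by force
qed

lemma decidable_list_mem [recursive_intros]:
  assumes "recursive f" "recursive g" shows "decidable (\<lambda>x. list_mem (f x) (g x))"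
proof -
  have "decidable (\<lambda>x. list_mem (pfst x) (psnd x))"
    unfolding list_mem_def by (intro recursive_intros)
  from recursive_comp[OF this[unfolded decidable_def], of "\<lambda>x. prod_encode (f x, g x)"] assms
  show ?thesis by (simp add: recursive_intros decidable_def)
qed

text \<open>Minimization finds the least witness, to which \<open>h\<close> is applied. The caller
  only learns that some witness was found, so \<open>P\<close> itself has to guarantee that every
  witness yields the right result.\<close>

lemma partial_recursive_search:
  assumes "decidable (\<lambda>e. P (pfst e) (psnd e))" "recursive h"
  obtains F where "partial_recursive F"
    and "\<And>x c. P x c \<Longrightarrow> \<exists>c'. P x c' \<and> F x = Some (h c')"
proof -
  \<comment> \<open>Minimization searches in the first argument for the value 0, hence the swapped
    arguments and the negation.\<close>
  have "total_recursive 2 (\<lambda>ys. of_bool (\<not> P (ys ! 1) (ys ! 0)))"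
    using total_recursive_comp1[OF decidable_not[OF assms(1), unfolded decidable_def recursive_def],
        of 2 "\<lambda>ys. prod_encode (ys ! 1, ys ! 0)"]
    by (simp add: total_recursive_prod_encode total_recursive_proj)
  then obtain p where p: "\<And>c x. reval p [c, x] (of_bool (\<not> P x c))"
    unfolding total_recursive_def by (metis One_nat_def length_Cons list.size(3) nth_Cons_0 nth_Cons_Suc numeral_2_eq_2)
  obtain r where r: "\<And>c. reval r [c] (h c)"
    using assms(2) unfolding recursive_def total_recursive_def
    by (metis One_nat_def length_Cons list.size(3) nth_Cons_0)
  define f where "f = Comp r [Mu p]"
  define F where "F x = (if \<exists>y. reval f [x] y then Some (THE y. reval f [x] y) else None)" for x
  have "(THE y. reval f [x] y) = y" if "reval f [x] y" for x y
    using that reval_deterministic by (intro the_equality) auto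
  then have F: "F x = Some y \<longleftrightarrow> reval f [x] y" for x y
    unfolding F_def by (metis option.distinct(1) option.inject)
  show ?thesis
  proof
    show "partial_recursive F" unfolding partial_recursive_def using F by blast
  next
    fix x c assume "P x c"
    define c' where "c' = (LEAST c. P x c)"
    have c': "P x c'" unfolding c'_def using \<open>P x c\<close> by (rule LeastI)
    have "\<not> P x m" if "m < c'" for m using not_less_Least that unfolding c'_def by blast
    then have "\<exists>k. reval p (m # [x]) (Suc k)" if "m < c'" for m using p[of m x] that by auto
    moreover have "reval p (c' # [x]) 0" using p[of c' x] c' by simp
    ultimately have "reval (Mu p) [x] c'" using reval.mu by blast
    then have "reval f [x] (h c')" unfolding f_def using r[of c']
      by (intro reval.comp[where ys = "[c']"]) auto
    then show "\<exists>c'. P x c' \<and> F x = Some (h c')" using c' F by blast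
  qed
qed

section \<open>Integer-valued recursive functions, as differences of natural ones\<close>

definition int_recursive :: "(nat \<Rightarrow> int) \<Rightarrow> bool" where
  "int_recursive f \<longleftrightarrow> (\<exists>g h. recursive g \<and> recursive h \<and> (\<forall>x. f x = int (g x) - int (h x)))"

lemma int_recursiveI:
  "recursive g \<Longrightarrow> recursive h \<Longrightarrow> (\<And>x. f x = int (g x) - int (h x)) \<Longrightarrow> int_recursive f"
  unfolding int_recursive_def by blast

lemma int_recursive_int [recursive_intros]: "recursive f \<Longrightarrow> int_recursive (\<lambda>x. int (f x))"
  by (rule int_recursiveI[of f "\<lambda>_. 0"]) (auto intro: recursive_intros)

lemma int_recursive_const [recursive_intros]: "int_recursive (\<lambda>_. k)"
  by (rule int_recursiveI[of "\<lambda>_. nat k" "\<lambda>_. nat (- k)"]) (auto intro: recursive_intros)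

lemma int_recursive_diff [recursive_intros]:
  assumes "int_recursive f" "int_recursive g" shows "int_recursive (\<lambda>x. f x - g x)"
proof -
  obtain a b c d where r: "recursive a" "recursive b" "recursive c" "recursive d"
    and "\<And>x. f x = int (a x) - int (b x)" "\<And>x. g x = int (c x) - int (d x)"
    using assms unfolding int_recursive_def by blast
  then show ?thesis
    by (intro int_recursiveI[of "\<lambda>x. a x + d x" "\<lambda>x. b x + c x"] recursive_intros) auto
qed

lemma int_recursive_add [recursive_intros]:
  "int_recursive f \<Longrightarrow> int_recursive g \<Longrightarrow> int_recursive (\<lambda>x. f x + g x)"
  using int_recursive_diff[OF _ int_recursive_diff[OF int_recursive_const[of 0]], of f g] by simp

lemma int_recursive_mult [recursive_intros]:
  assumes "int_recursive f" "int_recursive g" shows "int_recursive (\<lambda>x. f x * g x)"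
proof -
  obtain a b c d where r: "recursive a" "recursive b" "recursive c" "recursive d"
    and e: "\<And>x. f x = int (a x) - int (b x)" "\<And>x. g x = int (c x) - int (d x)"
    using assms unfolding int_recursive_def by blast
  show ?thesis
    by (rule int_recursiveI[of "\<lambda>x. a x * c x + b x * d x" "\<lambda>x. a x * d x + b x * c x"])
      (auto intro!: recursive_intros r simp: e algebra_simps)
qed

lemma decidable_int_eq [recursive_intros]:
  assumes "int_recursive f" "int_recursive g" shows "decidable (\<lambda>x. f x = g x)"
proof -
  obtain a b c d where r: "recursive a" "recursive b" "recursive c" "recursive d"
    and e: "\<And>x. f x = int (a x) - int (b x)" "\<And>x. g x = int (c x) - int (d x)"
    using assms unfolding int_recursive_def by blast
  have "(\<lambda>x. f x = g x) = (\<lambda>x. a x + d x = c x + b x)" by (auto simp: e fun_eq_iff)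
  then show ?thesis using r by (auto intro!: recursive_intros)
qed

lemma int_recursive_int_decode [recursive_intros]:
  assumes "recursive f" shows "int_recursive (\<lambda>x. int_decode (f x))"
proof -
  have "rec_nat 0 (\<lambda>i r. if even i then r else Suc r) n = n div 2" for n
    by (induction n) auto
  moreover have "recursive (\<lambda>x. rec_nat 0 (\<lambda>i r. if even i then r else Suc r) (f x))"
    using assms by (intro recursive_intros) auto
  ultimately have h: "recursive (\<lambda>x. f x div 2)" by simp
  \<comment> \<open>The code \<open>n\<close> stands for \<open>n div 2\<close> if it is even and
    for \<open>- (n div 2) - 1\<close> if it is odd.\<close>
  show ?thesis
    by (rule int_recursiveI[of "\<lambda>x. if even (f x) then f x div 2 else 0"
        "\<lambda>x. if even (f x) then 0 else Suc (f x div 2)"])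
      (auto intro!: recursive_intros h assms simp: int_decode_def sum_decode_def)
qed

section \<open>Continued fractions with periodic digits\<close>

text \<open>The numerators of the convergents; the start values reflect
  \<open>a\<^sub>0 = 0\<close>.\<close>

fun conv_num :: "real \<Rightarrow> nat \<Rightarrow> nat" where
  "conv_num \<gamma> 0 = 0"
| "conv_num \<gamma> (Suc 0) = 1"
| "conv_num \<gamma> (Suc (Suc i)) =
     cf_digit \<gamma> (Suc (Suc i)) * conv_num \<gamma> (Suc i) + conv_num \<gamma> i"

lemma inverse_in_Rats_iff: "inverse (x::real) \<in> \<rat> \<longleftrightarrow> x \<in> \<rat>"
  by (metis Rats_inverse inverse_inverse_eq)

lemma frac_in_Rats_iff: "frac (x::real) \<in> \<rat> \<longleftrightarrow> x \<in> \<rat>"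
proof -
  have "x = frac x + of_int \<lfloor>x\<rfloor>" by (simp add: frac_def)
  then show ?thesis by (metis Rats_add Rats_diff Rats_of_int frac_def)
qed

lemma nat_cases_Suc_Suc:
  obtains "n = 0" | "n = Suc 0" | k where "n = Suc (Suc k)"
  by (metis not0_implies_Suc)

text \<open>The period is taken even, so that \<open>p\<^sub>N\<^sub>-\<^sub>1 - q\<^sub>N\<^sub>-\<^sub>1 \<gamma>\<close> is positive.\<close>

locale periodic_cf =
  fixes \<gamma> :: real and N :: nat
  assumes gamma_pos: "0 < \<gamma>" and gamma_less_1: "\<gamma> < 1" and gamma_irrational: "\<gamma> \<notin> \<rat>"
    and even_N: "even N" and N_pos: "N > 0"
    and digit_periodic: "cf_digit \<gamma> (Suc (i + N)) = cf_digit \<gamma> (Suc i)"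
begin

abbreviation "a \<equiv> cf_digit \<gamma>"
abbreviation "q \<equiv> conv_denom \<gamma>"
abbreviation "p \<equiv> conv_num \<gamma>"

lemma cf_rem_irrational: "cf_rem \<gamma> i \<notin> \<rat>"
proof (induction i)
  case 0
  then show ?case using gamma_irrational by simp
next
  case (Suc i)
  then show ?case
    using inverse_in_Rats_iff[of "frac (cf_rem \<gamma> i)"] frac_in_Rats_iff[of "cf_rem \<gamma> i"]
    by (simp add: inverse_eq_divide)
qed

section \<open>Iterates of the Gauss map and the errors of the convergents\<close>

definition gauss :: "nat \<Rightarrow> real" where "gauss i = frac (cf_rem \<gamma> i)"

lemma gauss_pos: "0 < gauss i" and gauss_less_1: "gauss i < 1"
proof -
  have "gauss i \<noteq> 0" unfolding gauss_def
    using cf_rem_irrational[of i] frac_in_Rats_iff[of "cf_rem \<gamma> i"] by (metis Rats_0)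
  then show "0 < gauss i" using frac_ge_0[of "cf_rem \<gamma> i"] unfolding gauss_def by linarith
  show "gauss i < 1" unfolding gauss_def by (rule frac_lt_1)
qed

lemma a_Suc_pos: "a (Suc i) \<ge> 1" and inverse_gauss: "1 / gauss i = a (Suc i) + gauss (Suc i)"
proof -
  have "1 / gauss i \<ge> 1" using gauss_pos[of i] gauss_less_1[of i] by simp
  then have ge: "\<lfloor>1 / gauss i\<rfloor> \<ge> 1" by simp
  moreover have a: "a (Suc i) = nat \<lfloor>1 / gauss i\<rfloor>" by (simp add: cf_digit_def cf_coeff_def gauss_def)
  ultimately show "a (Suc i) \<ge> 1" by linarith
  have "gauss (Suc i) = frac (1 / gauss i)" by (simp add: gauss_def)
  then show "1 / gauss i = a (Suc i) + gauss (Suc i)" using ge by (simp add: a frac_def del: one_le_floor)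
qed

definition \<theta> :: "nat \<Rightarrow> real" where "\<theta> i = q i * \<gamma> - p i"

text \<open>The errors satisfy the same recurrence as \<open>p\<close> and \<open>q\<close>.
  Inserting \<open>1 / gauss i = a (Suc i) + gauss (Suc i)\<close> cancels the partial quotient, so
  successive errors have ratio minus a Gauss iterate.\<close>

lemma theta_Suc: "\<theta> (Suc i) = - gauss (Suc i) * \<theta> i"
proof (induction i rule: less_induct)
  case (less i)
  have gauss_0: "gauss 0 = \<gamma>" using gamma_pos gamma_less_1 by (simp add: gauss_def frac_eq)
  show ?case
  proof (cases i)
    case 0
    have "1 = (a 1 + gauss 1) * \<gamma>" using inverse_gauss[of 0] gauss_0 gamma_pos by (simp add: field_simps)
    then show ?thesis using 0 by (simp add: \<theta>_def algebra_simps)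
  next
    case (Suc j)
    have j: "\<theta> (Suc j) = - gauss (Suc j) * \<theta> j" using less[of j] Suc by simp
    then have "\<theta> j = - \<theta> (Suc j) * (a (Suc (Suc j)) + gauss (Suc (Suc j)))"
      using gauss_pos[of "Suc j"] by (simp flip: inverse_gauss)
    moreover have "\<theta> (Suc (Suc j)) = a (Suc (Suc j)) * \<theta> (Suc j) + \<theta> j"
      by (simp add: \<theta>_def algebra_simps)
    ultimately show ?thesis using Suc by (simp add: algebra_simps)
  qed
qed

lemma theta_sign: "0 < (-1) ^ i * \<theta> i" "\<bar>\<theta> i\<bar> < 1"
proof (induction i)
  case 0
  show "0 < (-1) ^ 0 * \<theta> 0" "\<bar>\<theta> 0\<bar> < 1" using gamma_pos gamma_less_1 by (auto simp: \<theta>_def)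
next
  case (Suc i)
  show "0 < (-1) ^ Suc i * \<theta> (Suc i)"
    using Suc(1) mult_pos_pos[OF gauss_pos[of "Suc i"] Suc(1)] by (simp add: theta_Suc algebra_simps)
  have "\<bar>\<theta> (Suc i)\<bar> = gauss (Suc i) * \<bar>\<theta> i\<bar>" using gauss_pos[of "Suc i"] by (simp add: theta_Suc abs_mult)
  also have "\<dots> < 1" using gauss_pos[of "Suc i"] gauss_less_1[of "Suc i"] Suc(2)
    by (metis abs_ge_zero less_eq_real_def mult_strict_mono' mult_1 )
  finally show "\<bar>\<theta> (Suc i)\<bar> < 1" .
qed

lemma q_pos: "q i > 0"
  using a_Suc_pos by (induction \<gamma> i rule: conv_denom.induct) (auto simp: Suc_le_eq)

lemma q_Suc_ge: "q i \<le> q (Suc i)"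
proof (cases i)
  case 0
  then show ?thesis using a_Suc_pos[of 0] by simp
next
  case (Suc j)
  then show ?thesis using a_Suc_pos[of "Suc j"] mult_le_mono1[of 1 "a (Suc (Suc j))" "q (Suc j)"]
    by (simp add: trans_le_add1)
qed

lemma q_mono: "i \<le> j \<Longrightarrow> q i \<le> q j"
  using q_Suc_ge by (rule lift_Suc_mono_le)

lemma q_Suc_Suc_ge: "q (Suc i) + q i \<le> q (Suc (Suc i))"
  using a_Suc_pos[of "Suc i"] mult_le_mono1[of 1 "a (Suc (Suc i))" "q (Suc i)"] by simp

text \<open>If \<open>a 1 = 1\<close> then \<open>q 0 = q 1\<close>, hence the condition
  \<open>1 \<le> i\<close>.\<close>

lemma q_strict: "1 \<le> i \<Longrightarrow> i < j \<Longrightarrow> q i < q j"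
proof -
  assume i: "1 \<le> i" "i < j"
  then obtain k where k: "i = Suc k" by (cases i) auto
  have "q i < q (Suc i)" unfolding k using q_Suc_Suc_ge[of k] q_pos[of k] by linarith
  also have "\<dots> \<le> q j" using i by (intro q_mono) auto
  finally show ?thesis .
qed

lemma q_ge: "i \<le> q i"
proof (induction i rule: less_induct)
  case (less i)
  show ?case
  proof (cases "i \<le> 1")
    case True
    then have "i = 0 \<or> i = 1" by auto
    then show ?thesis using a_Suc_pos[of 0] by auto
  next
    case False
    then obtain k where k: "i = Suc (Suc k)" by (cases i rule: nat_cases_Suc_Suc) auto
    show ?thesis unfolding k using less[of "Suc k"] k q_pos[of k] q_Suc_Suc_ge[of k] by linarith
  qed
qed

section \<open>Shifts by multiples of the period\<close>

lemma digit_periodic_dvd: "N dvd b \<Longrightarrow> 1 \<le> i \<Longrightarrow> a (i + b) = a i"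
proof -
  assume "N dvd b" "1 \<le> i"
  then obtain k j where b: "b = k * N" and i: "i = Suc j" by (metis Suc_le_D One_nat_def dvd_def mult.commute)
  have "a (Suc j + k * N) = a (Suc j)"
  proof (induction k)
    case (Suc k)
    then show ?case using digit_periodic[of "j + k * N"] by (simp add: algebra_simps)
  qed simp
  then show ?thesis using b i by simp
qed

lemma determinant: "int (q (Suc i)) * int (p i) - int (q i) * int (p (Suc i)) = (-1) ^ Suc i"
proof (induction i)
  case (Suc i)
  have "int (q (Suc (Suc i))) * int (p (Suc i)) - int (q (Suc i)) * int (p (Suc (Suc i))) =
    - (int (q (Suc i)) * int (p i) - int (q i) * int (p (Suc i)))"
    by (simp add: algebra_simps)
  then show ?case using Suc by simp
qed simp

text \<open>For a positive multiple \<open>b\<close> of the period, the map from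
  \<open>(q i, p i)\<close> to \<open>(q (i + b), p (i + b))\<close> is a matrix with rows
  \<open>(q b, q (b - 1))\<close> and \<open>(p b, p (b - 1))\<close>. \<open>\<mu> b\<close> is its
  eigenvalue for the left eigenvector \<open>(\<gamma>, -1)\<close>, and \<open>T b\<close> below is
  its trace.\<close>

definition \<mu> :: "nat \<Rightarrow> real" where "\<mu> b = p (b - 1) - q (b - 1) * \<gamma>"

definition T :: "nat \<Rightarrow> nat" where "T b = q b + p (b - 1)"

context
  fixes b :: nat assumes b_dvd: "N dvd b" and b_pos: "b > 0"
begin

lemma even_b: "even b" using even_N b_dvd by (rule dvd_trans)

text \<open>The partial quotients after position \<open>b\<close> repeat those from position 1 on,
  so both sides satisfy the same recurrence.\<close>

lemma q_shift: "q (i + b) = q b * q i + q (b - 1) * p i"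
proof (induction i rule: less_induct)
  case (less i)
  obtain c where c: "b = Suc c" using b_pos by (cases b) auto
  show ?case
  proof (cases i rule: nat_cases_Suc_Suc)
    case 1
    then show ?thesis by simp
  next
    case 2
    then show ?thesis using digit_periodic_dvd[OF b_dvd, of 1] c by (simp add: algebra_simps)
  next
    case (3 j)
    have "q (i + b) = a (i + b) * q (Suc j + b) + q (j + b)" using 3 by simp
    also have "a (i + b) = a i" using digit_periodic_dvd[OF b_dvd, of i] 3 by simp
    also have "q (Suc j + b) = q b * q (Suc j) + q (b - 1) * p (Suc j)" using less[of "Suc j"] 3 by simp
    also have "q (j + b) = q b * q j + q (b - 1) * p j" using less[of j] 3 by simp
    finally show ?thesis using 3 by (simp add: algebra_simps)
  qed
qed

lemma p_shift: "p (i + b) = p b * q i + p (b - 1) * p i"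
proof (induction i rule: less_induct)
  case (less i)
  obtain c where c: "b = Suc c" using b_pos by (cases b) auto
  show ?case
  proof (cases i rule: nat_cases_Suc_Suc)
    case 1
    then show ?thesis by simp
  next
    case 2
    then show ?thesis using digit_periodic_dvd[OF b_dvd, of 1] c by (simp add: algebra_simps)
  next
    case (3 j)
    have "p (i + b) = a (i + b) * p (Suc j + b) + p (j + b)" using 3 by simp
    also have "a (i + b) = a i" using digit_periodic_dvd[OF b_dvd, of i] 3 by simp
    also have "p (Suc j + b) = p b * q (Suc j) + p (b - 1) * p (Suc j)" using less[of "Suc j"] 3 by simp
    also have "p (j + b) = p b * q j + p (b - 1) * p j" using less[of j] 3 by simp
    finally show ?thesis using 3 by (simp add: algebra_simps)
  qed
qed

text \<open>Boundedness of \<open>q\<^sub>i \<gamma> - p\<^sub>i\<close> yields the quadratic equation of \<open>\<gamma>\<close>, without the uniqueness of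
  continued fraction expansions.\<close>

lemma quadratic_equation: "q b * \<gamma> - p b = \<mu> b * \<gamma>"
proof -
  define X where "X = q b * \<gamma> - p b"
  define z where "z = X - \<mu> b * \<gamma>"
  \<comment> \<open>\<open>z\<close> is the defect of the claimed equation. The shift formulas give
    \<open>\<theta> (i + b) = z * q i + \<mu> b * \<theta> i\<close>, where all errors are bounded
    while \<open>q i\<close> is not.\<close>
  have "\<bar>z\<bar> * real i \<le> 1 + \<bar>\<mu> b\<bar>" for i
  proof -
    have "\<theta> (i + b) = X * q i - \<mu> b * p i"
      unfolding \<theta>_def X_def \<mu>_def q_shift p_shift by (simp add: algebra_simps)
    also have "\<dots> = z * q i + \<mu> b * \<theta> i" by (simp add: z_def \<theta>_def algebra_simps)
    finally have "\<bar>z\<bar> * q i = \<bar>\<theta> (i + b) - \<mu> b * \<theta> i\<bar>" by (simp add: abs_mult)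
    also have "\<dots> \<le> \<bar>\<theta> (i + b)\<bar> + \<bar>\<mu> b\<bar> * \<bar>\<theta> i\<bar>"
      using abs_triangle_ineq4[of "\<theta> (i + b)" "\<mu> b * \<theta> i"] by (simp add: abs_mult)
    also have "\<dots> \<le> 1 + \<bar>\<mu> b\<bar>"
      using theta_sign(2)[of i] theta_sign(2)[of "i + b"]
        mult_left_mono[of "\<bar>\<theta> i\<bar>" 1 "\<bar>\<mu> b\<bar>"] by linarith
    finally show ?thesis using mult_left_mono[of "real i" "real (q i)" "\<bar>z\<bar>"] q_ge[of i] by linarith
  qed
  then have "\<not> \<bar>z\<bar> > 0" using reals_Archimedean3[of "\<bar>z\<bar>"]
    by (metis linorder_not_less mult.commute)
  then show ?thesis by (simp add: z_def X_def)
qed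

lemma mu_pos: "0 < \<mu> b"
proof -
  obtain c where c: "b = Suc c" using b_pos by (cases b) auto
  then have "odd c" using even_b by simp
  then have "(-1) ^ c * \<theta> c = \<mu> b" using c by (simp add: \<mu>_def \<theta>_def)
  then show ?thesis using theta_sign(1)[of c] by simp
qed

text \<open>The block matrix has determinant 1 because \<open>b\<close> is even, so its second
  eigenvalue \<open>T b - \<mu> b\<close> is the inverse of \<open>\<mu> b\<close>.\<close>

lemma T_mu: "(T b - \<mu> b) * \<mu> b = 1"
proof -
  obtain c where c: "b = Suc c" using b_pos by (cases b) auto
  have "int (q b) * int (p c) - int (q c) * int (p b) = 1"
    using determinant[of c] even_b c by simp
  then have "real_of_int (int (q b) * int (p c) - int (q c) * int (p b)) = 1" by (simp only: of_int_1)
  then have det: "real (q b) * p c - q c * p b = 1" by simp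
  have pb: "p b = q b * \<gamma> - \<mu> b * \<gamma>" using quadratic_equation by simp
  have "(T b - \<mu> b) * \<mu> b = (q b + q c * \<gamma>) * \<mu> b" by (simp add: T_def \<mu>_def c)
  also have "\<dots> = q b * \<mu> b + q c * (q b * \<gamma> - p b)"
    unfolding quadratic_equation by (simp add: algebra_simps)
  also have "\<dots> = 1" using det by (simp add: \<mu>_def c algebra_simps)
  finally show ?thesis .
qed

text \<open>From \<open>\<mu> b < 1\<close> one gets
  \<open>0 < (1 - \<mu> b)\<^sup>2 = (T b - 2) * \<mu> b\<close>, so the integer \<open>T b\<close>
  is at least 3, and then \<open>2 * \<mu> b < (T b - \<mu> b) * \<mu> b = 1\<close>. The first
  bound makes the limits of pumping well defined, the second gives the factor 2 in their
  approximation.\<close>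

lemma T_ge_3: "T b \<ge> 3" and mu_less_half: "\<mu> b < 1 / 2"
proof -
  have m1: "\<mu> b < 1"
    using theta_sign(2)[of "b - 1"] by (simp add: \<mu>_def \<theta>_def)
  have "0 < (1 - \<mu> b) * (1 - \<mu> b)" using m1 by (intro mult_pos_pos) auto
  also have "\<dots> = (real (T b) - 2) * \<mu> b" using T_mu by (simp add: algebra_simps)
  finally have "real (T b) > 2" using mu_pos zero_less_mult_pos2 by fastforce
  then show T: "T b \<ge> 3" by simp
  then have "2 * \<mu> b < (T b - \<mu> b) * \<mu> b" using m1 mu_pos by (intro mult_strict_right_mono) auto
  then show "\<mu> b < 1 / 2" using T_mu by simp
qed

text \<open>Cayley-Hamilton for the block matrix with trace \<open>T b\<close> and determinant
  1.\<close>

lemma q_recurrence: "q (i + 2 * b) + q i = T b * q (i + b)"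
proof -
  obtain c where c: "b = Suc c" using b_pos by (cases b) auto
  have det: "int (q b) * int (p c) - int (q c) * int (p b) = 1"
    using determinant[of c] even_b c by simp
  have "q (i + 2 * b) = q b * q (i + b) + q c * p (i + b)"
    using q_shift[of "i + b"] c by (simp add: mult_2 add.assoc)
  then have "int (q (i + 2 * b)) = q b * q (i + b) + q c * (p b * q i + p c * p i)"
    unfolding p_shift using c by simp
  also have "\<dots> = q b * q (i + b) + int (p c) * (q c * p i) + (int (q b) * p c - 1) * q i"
    using det by (simp add: algebra_simps)
  also have "\<dots> = q b * q (i + b) + int (p c) * (q b * q i + q c * p i) - q i"
    by (simp add: algebra_simps)
  also have "q b * q i + q c * p i = q (i + b)" using q_shift[of i] c by simp
  finally have "int (q (i + 2 * b) + q i) = int (T b * q (i + b))" by (simp add: T_def c algebra_simps)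
  then show ?thesis by (simp only: of_nat_eq_iff)
qed

lemma mu_irrational: "\<mu> b \<notin> \<rat>"
proof
  assume "\<mu> b \<in> \<rat>"
  then have "(p (b - 1) - \<mu> b) / q (b - 1) \<in> \<rat>" by (intro Rats_divide Rats_diff Rats_of_nat)
  then show False using gamma_irrational q_pos[of "b - 1"] by (simp add: \<mu>_def)
qed

text \<open>Provides the nonzero denominator when the equations of a pumped run are solved for
  \<alpha>.\<close>

lemma mu_diff_neq_0:
  fixes x y z :: nat
  assumes "y \<noteq> x" shows "(real z - real y) - \<mu> b * (real y - real x) \<noteq> 0"
proof
  assume "(real z - real y) - \<mu> b * (real y - real x) = 0"
  then have "\<mu> b = (real z - real y) / (real y - real x)" using assms by (simp add: field_simps)
  then show False using mu_irrational by simp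
qed

end

section \<open>Ostrowski digits\<close>

text \<open>Admissibility of the digits at positions below \<open>L\<close>, least significant
  first. Leading zeros are allowed, so that padded words are covered.\<close>

definition ostrowski_digits :: "(nat \<Rightarrow> nat) \<Rightarrow> nat \<Rightarrow> bool" where
  "ostrowski_digits e L \<longleftrightarrow>
     (\<forall>i<L. if i = 0 then e 0 < a 1 else e i \<le> a (Suc i) \<and> (e i = a (Suc i) \<longrightarrow> e (i - 1) = 0))"

definition digit_value :: "(nat \<Rightarrow> nat) \<Rightarrow> nat \<Rightarrow> nat" where
  "digit_value e L = (\<Sum>i<L. e i * q i)"

lemma digit_value_0 [simp]: "digit_value e 0 = 0"
  and digit_value_Suc [simp]: "digit_value e (Suc L) = digit_value e L + e L * q L"
  by (simp_all add: digit_value_def)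

lemma ostrowski_digits_mono: "ostrowski_digits e L \<Longrightarrow> M \<le> L \<Longrightarrow> ostrowski_digits e M"
  unfolding ostrowski_digits_def by (meson order_less_le_trans)

text \<open>If the top digit is maximal, the digit below it vanishes and the bound two positions
  lower suffices; otherwise the bound one position lower leaves room for it.\<close>

lemma digit_value_less: "ostrowski_digits e L \<Longrightarrow> digit_value e L < q L"
proof (induction L rule: less_induct)
  case (less L)
  show ?case
  proof (cases L rule: nat_cases_Suc_Suc)
    case 1
    then show ?thesis by simp
  next
    case 2
    then show ?thesis using less.prems by (simp add: ostrowski_digits_def)
  next
    case (3 k)
    have le: "e (Suc k) \<le> a L" "e (Suc k) = a L \<Longrightarrow> e k = 0"
      using less.prems 3 unfolding ostrowski_digits_def by (auto dest: spec[of _ "Suc k"])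
    have IH: "digit_value e (Suc k) < q (Suc k)" "digit_value e k < q k"
      using less 3 ostrowski_digits_mono by (meson lessI less_SucI le_SucI order_refl)+
    show ?thesis
    proof (cases "e (Suc k) = a L")
      case True
      then show ?thesis using le IH(2) 3 by simp
    next
      case False
      then have "e (Suc k) + 1 \<le> a L" using le by simp
      then have "(e (Suc k) + 1) * q (Suc k) \<le> a L * q (Suc k)" by (rule mult_le_mono1)
      then show ?thesis using IH(1) 3 by simp
    qed
  qed
qed

text \<open>The digits below \<open>L\<close> contribute less than \<open>q L\<close>, so the top
  digit is the quotient of the value by \<open>q L\<close>.\<close>

lemma ostrowski_digits_unique:
  assumes "ostrowski_digits e L" "ostrowski_digits f L" "digit_value e L = digit_value f L" "i < L"
  shows "e i = f i"
  using assms
proof (induction L)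
  case (Suc L)
  have d: "ostrowski_digits e L" "ostrowski_digits f L"
    using Suc.prems ostrowski_digits_mono le_SucI by blast+
  note lt = digit_value_less[OF d(1)] digit_value_less[OF d(2)]
  have "(digit_value e L + e L * q L) div q L = (digit_value f L + f L * q L) div q L"
    using Suc.prems(3) by simp
  then have "e L = f L" using lt q_pos[of L] by simp
  then show ?case using Suc d by (cases "i = L") auto
qed simp

text \<open>The greedy expansion: quotient by \<open>q L\<close> on top, remainder below. If the
  quotient is the maximal digit, then \<open>n < q (Suc L)\<close> leaves a remainder below
  \<open>q (L - 1)\<close>, which forces the next digit to be 0.\<close>

lemma ostrowski_digits_exist:
  "n < q L \<Longrightarrow> \<exists>e. ostrowski_digits e L \<and> digit_value e L = n"
proof (induction L arbitrary: n)
  case 0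
  then show ?case by (simp add: ostrowski_digits_def)
next
  case (Suc L)
  obtain e where e: "ostrowski_digits e L" "digit_value e L = n mod q L"
    using Suc.IH[of "n mod q L"] q_pos[of L] by auto
  define f where "f = e(L := n div q L)"
  have "digit_value f L = digit_value e L" unfolding digit_value_def f_def by (intro sum.cong) auto
  then have v: "digit_value f (Suc L) = n" using e by (simp add: f_def mod_div_mult_eq)
  have top: "if L = 0 then f 0 < a 1 else f L \<le> a (Suc L) \<and> (f L = a (Suc L) \<longrightarrow> f (L - 1) = 0)"
  proof (cases L)
    case 0
    then show ?thesis using Suc.prems by (simp add: f_def)
  next
    case (Suc k)
    have lt: "n < a (Suc L) * q L + q k" using Suc.prems Suc by simp
    also have "\<dots> \<le> (a (Suc L) + 1) * q L" using q_Suc_ge[of k] Suc by simp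
    finally have "f L \<le> a (Suc L)" by (simp add: f_def less_mult_imp_div_less flip: less_Suc_eq_le)
    moreover have "f k = 0" if "f L = a (Suc L)"
    proof -
      have "f k * q k \<le> digit_value e L" using Suc by (simp add: f_def)
      also have "digit_value e L + f L * q L = n" using e by (simp add: f_def mod_div_mult_eq)
      then have "digit_value e L < q k" using lt that by simp
      finally show ?thesis by simp
    qed
    ultimately show ?thesis using Suc by simp
  qed
  have "ostrowski_digits f (Suc L)"
    unfolding ostrowski_digits_def
  proof (intro allI impI)
    fix i assume "i < Suc L"
    show "if i = 0 then f 0 < a 1 else f i \<le> a (Suc i) \<and> (f i = a (Suc i) \<longrightarrow> f (i - 1) = 0)"
    proof (cases "i = L")
      case True
      show ?thesis using top unfolding True .
    next
      case False
      then have "i < L" using \<open>i < Suc L\<close> by simp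
      then show ?thesis using e(1) by (auto simp: ostrowski_digits_def f_def split: if_splits)
    qed
  qed
  then show ?case using v by blast
qed

section \<open>Representations as words, and padded pairs\<close>

lemma is_ostrowski_rep_iff:
  "is_ostrowski_rep \<gamma> n w \<longleftrightarrow> ostrowski_digits (\<lambda>i. rev w ! i) (length w) \<and>
    digit_value (\<lambda>i. rev w ! i) (length w) = n \<and> (w \<noteq> [] \<longrightarrow> rev w ! (length w - 1) \<noteq> 0)"
proof -
  have "w \<noteq> [] \<Longrightarrow> hd w = rev w ! (length w - 1)" by (simp add: rev_nth hd_conv_nth)
  then show ?thesis
    unfolding is_ostrowski_rep_def Let_def ostrowski_digits_def digit_value_def
    by (cases "w = []") (auto simp: Suc_le_eq)
qed

lemma leading_digit_le: "L > 0 \<Longrightarrow> e (L - 1) \<noteq> 0 \<Longrightarrow> q (L - 1) \<le> digit_value e L"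
  by (cases L) (auto simp: trans_le_add2)

text \<open>Taking the least possible number of positions makes the leading digit nonzero.
  Conversely, a nonzero leading digit forces \<open>q (length w - 1) \<le> n < q (length w)\<close>,
  which fixes the length.\<close>

lemma ostrowski_rep_ex1: "\<exists>!w. is_ostrowski_rep \<gamma> n w"
proof (rule ex_ex1I)
  let ?P = "\<lambda>L. \<exists>e. ostrowski_digits e L \<and> digit_value e L = n"
  have "n < q (Suc n)" using q_ge[of "Suc n"] by simp
  then have ex: "?P (Suc n)" by (rule ostrowski_digits_exist)
  define L where "L = (LEAST L. ?P L)"
  obtain e where e: "ostrowski_digits e L" "digit_value e L = n"
    using LeastI[of ?P, OF ex] unfolding L_def by blast
  have top: "e (L - 1) \<noteq> 0" if L0: "L > 0"
  proof
    assume z: "e (L - 1) = 0"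
    obtain k where k: "L = Suc k" using L0 by (cases L) auto
    then have "?P k" using e z ostrowski_digits_mono[OF e(1), of k] by auto
    then show False using not_less_Least[of k ?P] k unfolding L_def by auto
  qed
  let ?w = "rev (map e [0..<L])"
  have "ostrowski_digits (\<lambda>i. rev ?w ! i) L"
    using e(1) unfolding ostrowski_digits_def by auto
  moreover have "digit_value (\<lambda>i. rev ?w ! i) L = digit_value e L"
    unfolding digit_value_def by (intro sum.cong) auto
  ultimately show "\<exists>w. is_ostrowski_rep \<gamma> n w"
    using e top by (intro exI[of _ ?w]) (auto simp: is_ostrowski_rep_iff)
next
  have len: "length w \<le> length v" if "is_ostrowski_rep \<gamma> n w" "is_ostrowski_rep \<gamma> n v" for v w
  proof (rule ccontr)
    assume l: "\<not> length w \<le> length v"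
    have "n < q (length v)" using that(2) digit_value_less unfolding is_ostrowski_rep_iff by blast
    also have "\<dots> \<le> q (length w - 1)" using l by (intro q_mono) auto
    also have "\<dots> \<le> n"
      using that(1) l leading_digit_le[of "length w" "\<lambda>i. rev w ! i"] unfolding is_ostrowski_rep_iff by fastforce
    finally show False by simp
  qed
  fix w v assume wv: "is_ostrowski_rep \<gamma> n w" "is_ostrowski_rep \<gamma> n v"
  have l: "length w = length v" using len wv by (simp add: le_antisym)
  have "rev w = rev v"
  proof (rule nth_equalityI)
    fix i assume "i < length (rev w)"
    then show "rev w ! i = rev v ! i"
      using wv l ostrowski_digits_unique[of "\<lambda>i. rev w ! i" "length w" "\<lambda>i. rev v ! i" i]
      unfolding is_ostrowski_rep_iff by auto
  qed (simp add: l)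
  then show "w = v" by simp
qed

lemma is_ostrowski_rep_rep: "is_ostrowski_rep \<gamma> n (ostrowski_rep \<gamma> n)"
  unfolding ostrowski_rep_def using ostrowski_rep_ex1 by (rule theI')

text \<open>That only the shorter word is padded means that the two leading digits are not both
  0.\<close>

definition ostrowski_digit_pair :: "nat \<Rightarrow> nat \<Rightarrow> nat \<Rightarrow> (nat \<Rightarrow> nat) \<Rightarrow> (nat \<Rightarrow> nat) \<Rightarrow> bool" where
  "ostrowski_digit_pair n y L e f \<longleftrightarrow> L > 0 \<and> ostrowski_digits e L \<and> ostrowski_digits f L \<and>
     digit_value e L = n \<and> digit_value f L = y \<and> (e (L - 1) \<noteq> 0 \<or> f (L - 1) \<noteq> 0)"

lemma ostrowski_digits_padded:
  assumes "is_ostrowski_rep \<gamma> n w" "length w \<le> L"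
  defines "e \<equiv> \<lambda>i. rev (replicate (L - length w) 0 @ w) ! i"
  shows "ostrowski_digits e L" "digit_value e L = n" "L = length w \<Longrightarrow> L > 0 \<Longrightarrow> e (L - 1) \<noteq> 0"
proof -
  have e: "e i = (if i < length w then rev w ! i else 0)" if "i < L" for i
    using that by (simp add: e_def nth_append)
  have "ostrowski_digits (\<lambda>i. rev w ! i) (length w)" using assms(1) by (simp add: is_ostrowski_rep_iff)
  \<comment> \<open>All partial quotients are at least 1, so a padding zero is never a maximal
    digit.\<close>
  then show "ostrowski_digits e L"
    unfolding ostrowski_digits_def using a_Suc_pos
    by (auto simp: e Suc_le_eq neq0_conv[symmetric] simp del: neq0_conv)
  have "digit_value e L = (\<Sum>i<length w. e i * q i)"
    unfolding digit_value_def using assms(2) by (intro sum.mono_neutral_right) (auto simp: e)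
  also have "\<dots> = n" using assms(1,2) by (auto simp: is_ostrowski_rep_iff digit_value_def e)
  finally show "digit_value e L = n" .
  show "L = length w \<Longrightarrow> L > 0 \<Longrightarrow> e (L - 1) \<noteq> 0"
    using assms(1) e[of "L - 1"] by (auto simp: is_ostrowski_rep_iff)
qed

lemma ostrowski_pair_digits:
  assumes "n > 0"
  obtains L e f where "ostrowski_digit_pair n y L e f"
    and "ostrowski_pair \<gamma> n y = map (\<lambda>i. (e i, f i)) (rev [0..<L])"
proof -
  define u v where "u = ostrowski_rep \<gamma> n" and "v = ostrowski_rep \<gamma> y"
  define L where "L = max (length u) (length v)"
  define e f where "e = (\<lambda>i. rev (replicate (L - length u) 0 @ u) ! i)"
    and "f = (\<lambda>i. rev (replicate (L - length v) 0 @ v) ! i)"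
  have u: "is_ostrowski_rep \<gamma> n u" "length u \<le> L" and v: "is_ostrowski_rep \<gamma> y v" "length v \<le> L"
    by (simp_all add: u_def v_def L_def is_ostrowski_rep_rep)
  note eu = ostrowski_digits_padded[OF u, folded e_def]
  note fv = ostrowski_digits_padded[OF v, folded f_def]
  have "L > 0" using eu(2) assms by (cases L) auto
  then have "ostrowski_digit_pair n y L e f"
    using eu fv unfolding ostrowski_digit_pair_def by (auto simp: L_def max_def split: if_splits)
  moreover have "ostrowski_pair \<gamma> n y = map (\<lambda>i. (e i, f i)) (rev [0..<L])"
  proof -
    let ?U = "replicate (L - length u) 0 @ u" and ?V = "replicate (L - length v) 0 @ v"
    have len: "length ?U = L" "length ?V = L" using u v by auto
    have "L - length u = length v - length u" "L - length v = length u - length v"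
      by (auto simp: L_def)
    then have "ostrowski_pair \<gamma> n y = zip ?U ?V"
      by (simp add: ostrowski_pair_def pad_zip_def u_def v_def)
    also have "\<dots> = map (\<lambda>i. (e i, f i)) (rev [0..<L])"
    proof (rule nth_equalityI)
      fix i assume "i < length (zip ?U ?V)"
      then have i: "i < L" using len by simp
      then have "rev [0..<L] ! i = L - Suc i" by (simp add: rev_nth)
      moreover have "e (L - Suc i) = ?U ! i" "f (L - Suc i) = ?V ! i"
        unfolding e_def f_def using i len by (simp_all only: rev_nth) auto
      ultimately show "zip ?U ?V ! i = map (\<lambda>i. (e i, f i)) (rev [0..<L]) ! i"
        using i len by simp
    qed (use len in simp)
    finally show ?thesis .
  qed
  ultimately show ?thesis by (rule that)
qed

text \<open>The length is determined by the larger of \<open>n\<close> and \<open>y\<close>, as for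
  a single word. Hence digits produced by pumping are the actual representation of the pair of their
  values.\<close>

lemma ostrowski_digit_pair_unique:
  assumes "ostrowski_digit_pair n y L e f" "ostrowski_digit_pair n y L' e' f'"
  shows "L = L'" "i < L \<Longrightarrow> e i = e' i" "i < L \<Longrightarrow> f i = f' i"
proof -
  have len: "L \<le> M" if "ostrowski_digit_pair n y L e f" "ostrowski_digit_pair n y M e' f'" for L M e f e' f'
  proof (rule ccontr)
    assume l: "\<not> L \<le> M"
    have "max n y < q M" using that(2) digit_value_less unfolding ostrowski_digit_pair_def by auto
    also have "\<dots> \<le> q (L - 1)" using l by (intro q_mono) auto
    also have "\<dots> \<le> max n y"
      using that(1) leading_digit_le[of L e] leading_digit_le[of L f]
      unfolding ostrowski_digit_pair_def by auto
    finally show False by simp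
  qed
  show "L = L'" using len assms by (meson le_antisym)
  then show "i < L \<Longrightarrow> e i = e' i" "i < L \<Longrightarrow> f i = f' i"
    using assms ostrowski_digits_unique unfolding ostrowski_digit_pair_def by metis+
qed

lemma ostrowski_pair_eq:
  assumes "ostrowski_digit_pair n y L e f" "n > 0"
  shows "ostrowski_pair \<gamma> n y = map (\<lambda>i. (e i, f i)) (rev [0..<L])"
proof -
  obtain L' e' f' where *: "ostrowski_digit_pair n y L' e' f'"
    "ostrowski_pair \<gamma> n y = map (\<lambda>i. (e' i, f' i)) (rev [0..<L'])"
    using ostrowski_pair_digits[OF assms(2)] by metis
  show ?thesis
    unfolding *(2) using ostrowski_digit_pair_unique[OF *(1) assms(1)] by (auto intro!: map_cong)
qed

end

section \<open>Runs and pumping\<close>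

text \<open>States are indexed by position: \<open>st i\<close> is the state in which exactly the
  digits below position \<open>i\<close> remain to be read, so a run goes from \<open>st L\<close>
  down to \<open>st 0\<close>.\<close>

lemma reaches_map_rev_upt:
  "reaches A r (map c (rev [0..<L])) s \<longleftrightarrow>
    (\<exists>st. st L = r \<and> st 0 = s \<and> (\<forall>i<L. (st (Suc i), c i, st i) \<in> set (transitions A)))"
proof (induction L arbitrary: r)
  case 0
  show ?case by auto
next
  case (Suc L)
  have "reaches A r (map c (rev [0..<Suc L])) s \<longleftrightarrow>
      (\<exists>t. (r, c L, t) \<in> set (transitions A) \<and> (\<exists>st. st L = t \<and> st 0 = s \<and>
        (\<forall>i<L. (st (Suc i), c i, st i) \<in> set (transitions A))))"
    using Suc by simp
  also have "\<dots> \<longleftrightarrow> (\<exists>st. st (Suc L) = r \<and> st 0 = s \<and>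
      (\<forall>i<Suc L. (st (Suc i), c i, st i) \<in> set (transitions A)))" (is "?lhs \<longleftrightarrow> ?rhs")
  proof
    assume ?lhs
    then obtain st where "(r, c L, st L) \<in> set (transitions A)" "st 0 = s"
      "\<forall>i<L. (st (Suc i), c i, st i) \<in> set (transitions A)" by auto
    then show ?rhs by (intro exI[of _ "st(Suc L := r)"]) (auto simp: less_Suc_eq)
  next
    assume ?rhs
    then show ?lhs by (metis lessI less_SucI)
  qed
  finally show ?case .
qed

text \<open>The eigenvalue \<open>1 / \<mu> > 1\<close> of the recurrence cannot contribute to a bounded solution.\<close>

lemma bounded_linear_recurrence:
  fixes v :: "nat \<Rightarrow> real"
  assumes rec: "\<And>k. v (Suc (Suc k)) = t * v (Suc k) - v k"
    and mu: "(t - \<mu>) * \<mu> = 1" "0 < \<mu>" "\<mu> < 1" and bounded: "\<And>k. \<bar>v k\<bar> \<le> B"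
  shows "v (Suc k) = \<mu> * v k"
proof (rule ccontr)
  \<comment> \<open>\<open>d\<close> measures the part of the solution with ratio
    \<open>t - \<mu>\<close>: it vanishes on solutions of ratio \<open>\<mu>\<close> and is
    multiplied by \<open>t - \<mu> > 1\<close> in each step.\<close>
  define d where "d k = v (Suc k) - \<mu> * v k" for k
  assume "v (Suc k) \<noteq> \<mu> * v k"
  then have d: "\<bar>d k\<bar> > 0" by (simp add: d_def)
  have "1 = (t - \<mu>) * \<mu>" using mu by simp
  then have lam: "t - \<mu> > 1" using mu
    by (smt (verit) mult_left_le_one_le mult_less_cancel_right2 zero_less_mult_pos2)
  have "d (Suc k) = (t - \<mu>) * d k" for k
  proof -
    have "(t - \<mu>) * d k = (t - \<mu>) * v (Suc k) - ((t - \<mu>) * \<mu>) * v k" by (simp add: d_def algebra_simps)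
    then show ?thesis using mu(1) rec[of k] unfolding d_def by algebra
  qed
  then have pow: "d (k + j) = (t - \<mu>) ^ j * d k" for j by (induction j) auto
  obtain j where j: "2 * B / \<bar>d k\<bar> < (t - \<mu>) ^ j" using real_arch_pow[OF lam] by blast
  have "\<bar>d i\<bar> \<le> 2 * B" for i
  proof -
    have "\<mu> * \<bar>v i\<bar> \<le> \<bar>v i\<bar>" using mu by (intro mult_left_le_one_le) auto
    then have "\<bar>d i\<bar> \<le> \<bar>v (Suc i)\<bar> + \<bar>v i\<bar>"
      using abs_triangle_ineq4[of "v (Suc i)" "\<mu> * v i"] mu unfolding d_def abs_mult by simp
    then show ?thesis using bounded[of i] bounded[of "Suc i"] by linarith
  qed
  from this[of "k + j"] have "(t - \<mu>) ^ j * \<bar>d k\<bar> \<le> 2 * B" using lam by (simp add: pow abs_mult)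
  then show False using j d by (simp add: field_simps)
qed

text \<open>The offset is near \<beta> if \<open>n * \<alpha> + \<beta>\<close> lies just above an
  integer and near \<open>\<beta> - 1\<close> if it lies just below. Kronecker's theorem provides
  both.\<close>

lemma beatty_near_bounds:
  fixes \<alpha> \<beta> \<epsilon> :: real
  assumes "\<alpha> \<notin> \<rat>" "\<epsilon> > 0" "v = \<beta> \<or> v = \<beta> - 1"
  obtains n where "n \<ge> M" "n > 0" "\<bar>of_int (beatty \<alpha> \<beta> n) - real n * \<alpha> - v\<bar> < \<epsilon>"
proof -
  define \<delta> where "\<delta> = min \<epsilon> 1 / 2"
  define \<sigma> :: real where "\<sigma> = (if v = \<beta> then 1 else -1)"
  have \<delta>: "0 < \<delta>" "2 * \<delta> \<le> \<epsilon>" "2 * \<delta> \<le> 1" using assms(2) by (auto simp: \<delta>_def)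
  \<comment> \<open>With \<open>n = k + M\<close>, this target places
    \<open>n * \<alpha> + \<beta>\<close> within \<delta> of \<open>h + \<sigma> * \<delta>\<close>,
    hence strictly on the side of \<open>h\<close> chosen by \<sigma>.\<close>
  obtain h k where k: "k > 0"
    and hk: "\<bar>of_int k * \<alpha> - of_int h - (\<sigma> * \<delta> - \<beta> - real M * \<alpha>)\<bar> < \<delta>"
    using sequence_of_fractional_parts_is_dense[OF assms(1) \<delta>(1)] by metis
  define n where "n = nat k + M"
  have "real n * \<alpha> = of_int k * \<alpha> + real M * \<alpha>" using k by (simp add: n_def algebra_simps)
  then have z: "\<bar>real n * \<alpha> + \<beta> - of_int h - \<sigma> * \<delta>\<bar> < \<delta>" using hk by (simp add: algebra_simps)
  have "\<bar>of_int (beatty \<alpha> \<beta> n) - real n * \<alpha> - v\<bar> < \<epsilon>"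
  proof (cases "v = \<beta>")
    case True
    then have "beatty \<alpha> \<beta> n = h" using z \<delta> unfolding beatty_def \<sigma>_def by (intro floor_unique) auto
    then show ?thesis using True z \<delta> by (simp add: \<sigma>_def)
  next
    case False
    then have "beatty \<alpha> \<beta> n = h - 1" using z \<delta> unfolding beatty_def \<sigma>_def by (intro floor_unique) auto
    then show ?thesis using False assms(3) z \<delta> by (simp add: \<sigma>_def)
  qed
  then show ?thesis using that[of n] k by (simp add: n_def)
qed

context periodic_cf
begin

definition run :: "automaton \<Rightarrow> (nat \<Rightarrow> nat) \<Rightarrow> (nat \<Rightarrow> nat) \<Rightarrow> (nat \<Rightarrow> nat) \<Rightarrow> nat \<Rightarrow> bool" where
  "run A e f st L \<longleftrightarrow> L > 0 \<and> ostrowski_digits e L \<and> ostrowski_digits f L \<and>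
     (e (L - 1) \<noteq> 0 \<or> f (L - 1) \<noteq> 0) \<and> st L = initial A \<and> st 0 \<in> set (final A) \<and>
     (\<forall>i<L. (st (Suc i), (e i, f i), st i) \<in> set (transitions A))"

text \<open>The digits of a run are the representation of the pair of their values, so the run
  witnesses acceptance. Positivity excludes the index 0, about which nothing is assumed.\<close>

lemma run_value:
  assumes "synchronizes \<gamma> A s" "run A e f st L" "digit_value e L > 0"
  shows "s (digit_value e L) = int (digit_value f L)"
proof -
  have "ostrowski_digit_pair (digit_value e L) (digit_value f L) L e f"
    using assms(2) by (simp add: run_def ostrowski_digit_pair_def)
  from ostrowski_pair_eq[OF this assms(3)]
  have "accepts A (ostrowski_pair \<gamma> (digit_value e L) (digit_value f L))"
    using assms(2) unfolding accepts_def by (auto simp: reaches_map_rev_upt run_def)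
  then show ?thesis using assms(1,3) by (auto simp: synchronizes_def Suc_le_eq)
qed

text \<open>Digits and states are given by list codes, so that runs can later be enumerated.\<close>

lemma run_exists:
  assumes "synchronizes \<gamma> A s" "n > 0"
  obtains c d r L where "run A (list_nth c) (list_nth d) (list_nth r) L" "digit_value (list_nth c) L = n"
proof -
  define y where "y = nat (s n)"
  have acc: "accepts A (ostrowski_pair \<gamma> n y)" using assms by (auto simp: synchronizes_def y_def)
  obtain L e f where ef: "ostrowski_digit_pair n y L e f"
    "ostrowski_pair \<gamma> n y = map (\<lambda>i. (e i, f i)) (rev [0..<L])"
    using ostrowski_pair_digits[OF assms(2)] by metis
  then obtain st where "st L = initial A" "st 0 \<in> set (final A)"
    "\<forall>i<L. (st (Suc i), (e i, f i), st i) \<in> set (transitions A)"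
    using acc unfolding accepts_def ef(2) reaches_map_rev_upt by auto
  then have run: "run A e f st L" "digit_value e L = n"
    using ef(1) by (auto simp: run_def ostrowski_digit_pair_def)
  define code where "code h = list_encode (map h [0..<Suc L])" for h :: "nat \<Rightarrow> nat"
  have code: "list_nth (code h) k = h k" if "k \<le> L" for h k
    using that list_nth_encode[of k "map h [0..<Suc L]"] unfolding code_def
    by (simp del: upt_Suc)
  have "ostrowski_digits (list_nth (code h)) L \<longleftrightarrow> ostrowski_digits h L" for h
    unfolding ostrowski_digits_def by (simp add: code)
  then have "run A (list_nth (code e)) (list_nth (code f)) (list_nth (code st)) L"
    using run(1) unfolding run_def by (simp add: code)
  moreover have "digit_value (list_nth (code e)) L = n"
    using run(2) unfolding digit_value_def by (simp add: code)
  ultimately show ?thesis by (rule that)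
qed

text \<open>Besides the repeated state, equal digits just below \<open>i\<close> and
  \<open>j\<close> preserve the condition on neighbouring digits at the seam, divisibility by
  \<open>N\<close> preserves the digit bounds, and \<open>j < L\<close> keeps the leading digits
  outside the block.\<close>

definition loop :: "(nat \<Rightarrow> nat) \<Rightarrow> (nat \<Rightarrow> nat) \<Rightarrow> (nat \<Rightarrow> nat) \<Rightarrow> nat \<Rightarrow> nat \<Rightarrow> nat \<Rightarrow> bool" where
  "loop e f st L i j \<longleftrightarrow> 1 \<le> i \<and> i < j \<and> j < L \<and> N dvd j - i \<and>
     e (i - 1) = e (j - 1) \<and> f (i - 1) = f (j - 1) \<and> st i = st j"

text \<open>Positions are counted from the least significant digit; the block \<open>i, \<dots>, j - 1\<close> is read twice
  in \<open>dup i j\<close> and skipped in \<open>del i j\<close>.\<close>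

definition dup :: "nat \<Rightarrow> nat \<Rightarrow> (nat \<Rightarrow> nat) \<Rightarrow> nat \<Rightarrow> nat" where
  "dup i j h k = (if k < j then h k else h (k - (j - i)))"

definition del :: "nat \<Rightarrow> nat \<Rightarrow> (nat \<Rightarrow> nat) \<Rightarrow> nat \<Rightarrow> nat" where
  "del i j h k = (if k < i then h k else h (k + (j - i)))"

text \<open>Digits above the seam move by a multiple of the period, so their bounds do not change.
  The only new neighbours meet at position \<open>j\<close>, where
  \<open>e (i - 1) = e (j - 1)\<close> applies.\<close>

lemma ostrowski_digits_dup:
  assumes e: "ostrowski_digits e L" and ij: "1 \<le> i" "i < j" "j < L" "N dvd j - i" "e (i - 1) = e (j - 1)"
  shows "ostrowski_digits (dup i j e) (L + (j - i))"
  unfolding ostrowski_digits_def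
proof (intro allI impI)
  fix k assume k: "k < L + (j - i)"
  let ?E = "dup i j e"
  have E: "if k = 0 then e 0 < a 1 else e k \<le> a (Suc k) \<and> (e k = a (Suc k) \<longrightarrow> e (k - 1) = 0)"
    if "k < L" for k using e that unfolding ostrowski_digits_def by blast
  show "if k = 0 then ?E 0 < a 1 else ?E k \<le> a (Suc k) \<and> (?E k = a (Suc k) \<longrightarrow> ?E (k - 1) = 0)"
  proof (cases "k < j")
    case True
    then show ?thesis using E[of k] ij by (auto simp: dup_def)
  next
    case False
    define m where "m = k - (j - i)"
    have m: "m \<ge> i" "m < L" "k = m + (j - i)" using False k ij by (auto simp: m_def)
    have "a (Suc m + (j - i)) = a (Suc m)" using digit_periodic_dvd[OF ij(4), of "Suc m"] by simp
    then have am: "a (Suc k) = a (Suc m)" using m by simp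
    have "?E k = e m" using False by (simp add: dup_def m_def)
    moreover have "?E (k - 1) = e (m - 1)"
    proof (cases "k = j")
      case True
      then have "m = i" using m ij by simp
      then show ?thesis using True ij by (simp add: dup_def)
    next
      case False
      then show ?thesis using \<open>\<not> k < j\<close> by (simp add: dup_def m_def)
    qed
    ultimately show ?thesis using E[OF m(2)] am m ij by auto
  qed
qed

lemma ostrowski_digits_del:
  assumes e: "ostrowski_digits e L" and ij: "1 \<le> i" "i < j" "j < L" "N dvd j - i" "e (i - 1) = e (j - 1)"
  shows "ostrowski_digits (del i j e) (L - (j - i))"
  unfolding ostrowski_digits_def
proof (intro allI impI)
  fix k assume k: "k < L - (j - i)"
  let ?E = "del i j e"
  have E: "if k = 0 then e 0 < a 1 else e k \<le> a (Suc k) \<and> (e k = a (Suc k) \<longrightarrow> e (k - 1) = 0)"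
    if "k < L" for k using e that unfolding ostrowski_digits_def by blast
  show "if k = 0 then ?E 0 < a 1 else ?E k \<le> a (Suc k) \<and> (?E k = a (Suc k) \<longrightarrow> ?E (k - 1) = 0)"
  proof (cases "k < i")
    case True
    then show ?thesis using E[of k] ij by (auto simp: del_def)
  next
    case False
    define m where "m = k + (j - i)"
    have m: "m < L" "m \<noteq> 0" "k \<noteq> 0" using False k ij by (auto simp: m_def)
    have am: "a (Suc m) = a (Suc k)" using digit_periodic_dvd[OF ij(4), of "Suc k"] by (simp add: m_def)
    have "?E k = e m" using False by (simp add: del_def m_def)
    moreover have "?E (k - 1) = e (m - 1)"
    proof (cases "k = i")
      case True
      then have "m = j" using m_def ij by simp
      then show ?thesis using True ij by (simp add: del_def)
    next
      case False
      then show ?thesis using \<open>\<not> k < i\<close> by (simp add: del_def m_def)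
    qed
    ultimately show ?thesis using E[OF m(1)] am m by auto
  qed
qed

lemma run_dup:
  assumes "run A e f st L" "loop e f st L i j"
  shows "run A (dup i j e) (dup i j f) (dup i j st) (L + (j - i))"
proof -
  have ij: "1 \<le> i" "i < j" "j < L" "N dvd j - i" "e (i - 1) = e (j - 1)" "f (i - 1) = f (j - 1)"
    "st i = st j" using assms(2) by (auto simp: loop_def)
  have "(dup i j st (Suc k), (dup i j e k, dup i j f k), dup i j st k) \<in> set (transitions A)"
    if k: "k < L + (j - i)" for k
  proof -
    have tr: "(st (Suc m), (e m, f m), st m) \<in> set (transitions A)" if "m < L" for m
      using assms(1) that by (simp add: run_def)
    show ?thesis
    proof (cases "k < j")
      case True
      then have "dup i j st (Suc k) = st (Suc k)"
        using ij by (cases "Suc k = j") (auto simp: dup_def)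
      then show ?thesis using tr[of k] True ij by (auto simp: dup_def)
    next
      case False
      then have "Suc k - (j - i) = Suc (k - (j - i))" by (simp add: Suc_diff_le)
      then show ?thesis using tr[of "k - (j - i)"] False k by (auto simp: dup_def)
    qed
  qed
  then show ?thesis
    using assms(1) ij ostrowski_digits_dup[of e L i j] ostrowski_digits_dup[of f L i j]
    unfolding run_def by (auto simp: dup_def)
qed

lemma loop_dup: "loop e f st L i j \<Longrightarrow> loop (dup i j e) (dup i j f) (dup i j st) (L + (j - i)) i j"
  by (auto simp: loop_def dup_def)

lemma run_del:
  assumes "run A e f st L" "loop e f st L i j"
  shows "run A (del i j e) (del i j f) (del i j st) (L - (j - i))"
proof -
  have ij: "1 \<le> i" "i < j" "j < L" "N dvd j - i" "e (i - 1) = e (j - 1)" "f (i - 1) = f (j - 1)"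
    "st i = st j" using assms(2) by (auto simp: loop_def)
  have "(del i j st (Suc k), (del i j e k, del i j f k), del i j st k) \<in> set (transitions A)"
    if k: "k < L - (j - i)" for k
  proof -
    have tr: "(st (Suc m), (e m, f m), st m) \<in> set (transitions A)" if "m < L" for m
      using assms(1) that by (simp add: run_def)
    show ?thesis
    proof (cases "k < i")
      case True
      then have "del i j st (Suc k) = st (Suc k)"
        using ij by (cases "Suc k = i") (auto simp: del_def)
      then show ?thesis using tr[of k] True ij by (auto simp: del_def)
    next
      case False
      then show ?thesis using tr[of "k + (j - i)"] k by (auto simp: del_def)
    qed
  qed
  moreover have "L - (j - i) - 1 + (j - i) = L - 1" "\<not> L - (j - i) - 1 < i" "\<not> L - (j - i) < i"
    using ij by auto
  ultimately show ?thesis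
    using assms(1) ij ostrowski_digits_del[of e L i j] ostrowski_digits_del[of f L i j]
    unfolding run_def by (auto simp: del_def)
qed

section \<open>Values of pumped digit words\<close>

definition shifted_value :: "(nat \<Rightarrow> nat) \<Rightarrow> nat \<Rightarrow> nat \<Rightarrow> nat \<Rightarrow> real" where
  "shifted_value e l h s = (\<Sum>i=l..<h. real (e i) * real (q (i + s)))"

lemma shifted_value_split:
  "l \<le> m \<Longrightarrow> m \<le> h \<Longrightarrow> shifted_value e l h s = shifted_value e l m s + shifted_value e m h s"
  unfolding shifted_value_def by (simp add: sum.atLeastLessThan_concat)

lemma shifted_value_cong:
  "(\<And>i. l \<le> i \<Longrightarrow> i < h \<Longrightarrow> e i = e' i) \<Longrightarrow> shifted_value e l h s = shifted_value e' l h s"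
  unfolding shifted_value_def by (intro sum.cong) auto

lemma real_digit_value: "real (digit_value e L) = shifted_value e 0 L 0"
  by (simp add: digit_value_def shifted_value_def lessThan_atLeast0)

lemma shifted_value_dup:
  assumes "i < j" "j \<le> L"
  shows "shifted_value (dup i j e) j (L + (j - i)) s = shifted_value e i L (s + (j - i))"
proof -
  have "shifted_value (dup i j e) j (L + (j - i)) s =
      shifted_value (dup i j e) (i + (j - i)) (L + (j - i)) s" using assms by simp
  also have "\<dots> = (\<Sum>k=i..<L. real (dup i j e (k + (j - i))) * real (q (k + (j - i) + s)))"
    unfolding shifted_value_def by (rule sum.shift_bounds_nat_ivl)
  also have "\<dots> = shifted_value e i L (s + (j - i))"
    unfolding shifted_value_def using assms by (intro sum.cong) (auto simp: dup_def algebra_simps)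
  finally show ?thesis .
qed

text \<open>The digits below \<open>j\<close> stay in place, and on top of them everything from
  \<open>i\<close> on occurs once more, moved up by the block length.\<close>

lemma digit_value_dup:
  assumes "i < j" "j \<le> L"
  shows "real (digit_value (dup i j e) (L + (j - i))) =
    shifted_value e 0 j 0 + shifted_value e i L (j - i)"
proof -
  have "shifted_value (dup i j e) 0 j 0 = shifted_value e 0 j 0"
    by (rule shifted_value_cong) (simp add: dup_def)
  then show ?thesis
    using shifted_value_split[of 0 j "L + (j - i)" "dup i j e" 0] shifted_value_dup[OF assms, of e 0] assms
    by (simp add: real_digit_value)
qed

text \<open>The inhomogeneous term of the recurrence for the values of the pumped words. It involves
  only the digits below \<open>j\<close>.\<close>

definition pump_const :: "(nat \<Rightarrow> nat) \<Rightarrow> nat \<Rightarrow> nat \<Rightarrow> real" where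
  "pump_const e i j = (1 - real (T (j - i))) * shifted_value e 0 j 0 + shifted_value e i j (j - i) +
     shifted_value e 0 i 0"

lemma pump_const_cong:
  "i \<le> j \<Longrightarrow> (\<And>k. k < j \<Longrightarrow> e k = e' k) \<Longrightarrow> pump_const e i j = pump_const e' i j"
  unfolding pump_const_def by (intro arg_cong2[of _ _ _ _ "(+)"] arg_cong2[of _ _ _ _ "(*)"] shifted_value_cong refl) auto

lemma shifted_value_recurrence:
  assumes "N dvd b" "b > 0"
  shows "shifted_value e l h (2 * b) + shifted_value e l h 0 = T b * shifted_value e l h b"
proof -
  have "real (e i) * real (q (i + 2 * b)) + real (e i) * real (q (i + 0)) =
      real (T b) * (real (e i) * real (q (i + b)))" for i
  proof -
    have "real (q (i + 2 * b)) + real (q i) = real (T b) * real (q (i + b))"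
      using q_recurrence[OF assms, of i] by (metis of_nat_add of_nat_mult)
    then show ?thesis unfolding add_0_right by algebra
  qed
  then show ?thesis
    unfolding shifted_value_def sum_distrib_left sum.distrib[symmetric] by (intro sum.cong) auto
qed

text \<open>In the three words, the digits from \<open>i\<close> on contribute with shifts
  \<open>0\<close>, \<open>b\<close> and \<open>2 * b\<close> for \<open>b = j - i\<close>; these
  cancel by the recurrence of \<open>q\<close>.\<close>

lemma digit_value_dup_recurrence:
  assumes "i < j" "j < L" "N dvd j - i"
  shows "real (digit_value (dup i j (dup i j e)) (L + (j - i) + (j - i)))
    - T (j - i) * real (digit_value (dup i j e) (L + (j - i))) + real (digit_value e L) = pump_const e i j"
proof -
  let ?b = "j - i"
  have c1: "shifted_value (dup i j e) 0 j 0 = shifted_value e 0 j 0"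
    and c2: "shifted_value (dup i j e) i j ?b = shifted_value e i j ?b"
    by (rule shifted_value_cong; simp add: dup_def)+
  have 2: "real (digit_value (dup i j (dup i j e)) (L + ?b + ?b)) =
      shifted_value e 0 j 0 + (shifted_value e i j ?b + shifted_value e i L (2 * ?b))"
    using digit_value_dup[of i j "L + ?b" "dup i j e"] assms c1 c2 shifted_value_dup[of i j L e ?b]
      shifted_value_split[of i j "L + ?b" "dup i j e" ?b]
    by (simp add: mult_2)
  have 0: "real (digit_value e L) = shifted_value e 0 i 0 + shifted_value e i L 0"
    using shifted_value_split[of 0 i L e 0] assms by (simp add: real_digit_value)
  show ?thesis
    unfolding 2 0 digit_value_dup[OF assms(1) less_imp_le[OF assms(2)]] pump_const_def
    using shifted_value_recurrence[OF assms(3), of e i L] assms by (simp add: algebra_simps)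
qed

text \<open>The same recurrence continued one step backwards: now the digits from \<open>j\<close>
  on contribute with shifts \<open>-b\<close>, \<open>0\<close> and \<open>b\<close>, and the
  constant is unchanged.\<close>

lemma digit_value_del_recurrence:
  assumes "i < j" "j < L" "N dvd j - i"
  shows "real (digit_value (dup i j e) (L + (j - i)))
    - T (j - i) * real (digit_value e L) + real (digit_value (del i j e) (L - (j - i))) = pump_const e i j"
proof -
  let ?b = "j - i"
  have "shifted_value (del i j e) 0 i 0 = shifted_value e 0 i 0"
    by (rule shifted_value_cong) (simp add: del_def)
  moreover have "shifted_value (del i j e) i (L - ?b) 0 = (\<Sum>k=i..<L-?b. real (e (k + ?b)) * real (q k))"
    unfolding shifted_value_def by (intro sum.cong) (auto simp: del_def)
  ultimately have d: "real (digit_value (del i j e) (L - ?b)) =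
      shifted_value e 0 i 0 + (\<Sum>k=i..<L-?b. real (e (k + ?b)) * real (q k))"
    using shifted_value_split[of 0 i "L - ?b" "del i j e" 0] assms by (simp add: real_digit_value)
  have sh: "shifted_value e j L s = (\<Sum>k=i..<L-?b. real (e (k + ?b)) * real (q (k + ?b + s)))" for s
  proof -
    have "shifted_value e j L s = shifted_value e (i + ?b) (L - ?b + ?b) s" using assms by simp
    also have "\<dots> = (\<Sum>k=i..<L-?b. real (e (k + ?b)) * real (q (k + ?b + s)))"
      unfolding shifted_value_def by (rule sum.shift_bounds_nat_ivl)
    finally show ?thesis .
  qed
  have "real (e (k + ?b)) * real (q (k + ?b + ?b)) + real (e (k + ?b)) * real (q k) =
      real (T ?b) * (real (e (k + ?b)) * real (q (k + ?b + 0)))" for k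
  proof -
    have "real (q (k + ?b + ?b)) + real (q k) = real (T ?b) * real (q (k + ?b))"
      using q_recurrence[OF assms(3), of k] assms(1) unfolding mult_2 add.assoc
      by (metis of_nat_add of_nat_mult zero_less_diff)
    then show ?thesis unfolding add_0_right by algebra
  qed
  then have r: "shifted_value e j L ?b + (\<Sum>k=i..<L-?b. real (e (k + ?b)) * real (q k)) =
      T ?b * shifted_value e j L 0"
    unfolding sh sum_distrib_left sum.distrib[symmetric] by (intro sum.cong) auto
  have "real (digit_value e L) = shifted_value e 0 j 0 + shifted_value e j L 0"
    using shifted_value_split[of 0 j L e 0] assms by (simp add: real_digit_value)
  moreover have "shifted_value e i L ?b = shifted_value e i j ?b + shifted_value e j L ?b"
    using shifted_value_split[of i j L e ?b] assms by simp
  ultimately show ?thesis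
    unfolding d digit_value_dup[OF assms(1) less_imp_le[OF assms(2)]] pump_const_def
    using r by (simp add: algebra_simps)
qed

text \<open>Moving digits up does not decrease the value. A nonzero digit at or above
  \<open>j \<ge> 1\<close> makes it grow, since \<open>q\<close> is strictly increasing from index 1
  on.\<close>

lemma digit_value_dup_ge:
  assumes "1 \<le> i" "i < j" "j < L"
  shows "digit_value e L \<le> digit_value (dup i j e) (L + (j - i))"
    and "\<exists>k<L. j \<le> k \<and> e k > 0 \<Longrightarrow> digit_value e L < digit_value (dup i j e) (L + (j - i))"
proof -
  have e: "real (digit_value e L) = shifted_value e 0 j 0 + shifted_value e j L 0"
    using shifted_value_split[of 0 j L e 0] assms by (simp add: real_digit_value)
  have d: "real (digit_value (dup i j e) (L + (j - i))) =
      shifted_value e 0 j 0 + shifted_value e i j (j - i) + shifted_value e j L (j - i)"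
    using digit_value_dup[of i j L e] shifted_value_split[of i j L e "j - i"] assms by simp
  have nn: "shifted_value e i j (j - i) \<ge> 0" unfolding shifted_value_def by (intro sum_nonneg) auto
  have le: "real (e k) * real (q (k + 0)) \<le> real (e k) * real (q (k + (j - i)))" for k
    by (intro mult_left_mono) (auto intro: q_mono)
  then have "shifted_value e j L 0 \<le> shifted_value e j L (j - i)"
    unfolding shifted_value_def by (intro sum_mono)
  then show "digit_value e L \<le> digit_value (dup i j e) (L + (j - i))"
    using e d nn by linarith
  assume "\<exists>k<L. j \<le> k \<and> e k > 0"
  then obtain k where k: "k < L" "j \<le> k" "e k > 0" by blast
  have "real (e k) * real (q (k + 0)) < real (e k) * real (q (k + (j - i)))"
    using k assms by (auto intro: q_strict)
  then have "shifted_value e j L 0 < shifted_value e j L (j - i)"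
    unfolding shifted_value_def using k le by (intro sum_strict_mono_ex1 bexI[of _ k]) auto
  then show "digit_value e L < digit_value (dup i j e) (L + (j - i))" using e d nn by linarith
qed

section \<open>Offsets of the sequence from its linear part along pumped runs\<close>

definition run_offset :: "real \<Rightarrow> (nat \<Rightarrow> nat) \<Rightarrow> (nat \<Rightarrow> nat) \<Rightarrow> nat \<Rightarrow> real" where
  "run_offset \<alpha> e f L = real (digit_value f L) - \<alpha> * real (digit_value e L)"

text \<open>The fixed point of the recurrence for the offsets; the denominator is nonzero because
  the trace is at least 3.\<close>

definition pump_limit :: "real \<Rightarrow> (nat \<Rightarrow> nat) \<Rightarrow> (nat \<Rightarrow> nat) \<Rightarrow> nat \<Rightarrow> nat \<Rightarrow> real" where
  "pump_limit \<alpha> e f i j = (pump_const f i j - \<alpha> * pump_const e i j) / (2 - real (T (j - i)))"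

lemma run_offset_bounds:
  assumes "synchronizes \<gamma> A (beatty \<alpha> \<beta>)" "run A e f st L" "digit_value e L > 0"
  shows "\<beta> - 1 \<le> run_offset \<alpha> e f L" "run_offset \<alpha> e f L \<le> \<beta>"
proof -
  have "of_int (beatty \<alpha> \<beta> (digit_value e L)) = real (digit_value f L)"
    using run_value[OF assms] by simp
  then show "\<beta> - 1 \<le> run_offset \<alpha> e f L" "run_offset \<alpha> e f L \<le> \<beta>"
    unfolding run_offset_def beatty_def by (simp_all add: mult.commute) linarith+
qed

lemma run_offset_recurrence:
  assumes "i < j" "j < L" "N dvd j - i"
  shows "run_offset \<alpha> (dup i j (dup i j e)) (dup i j (dup i j f)) (L + (j - i) + (j - i)) - pump_limit \<alpha> e f i j =
      T (j - i) * (run_offset \<alpha> (dup i j e) (dup i j f) (L + (j - i)) - pump_limit \<alpha> e f i j)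
      - (run_offset \<alpha> e f L - pump_limit \<alpha> e f i j)" (is ?dup)
    and "run_offset \<alpha> (dup i j e) (dup i j f) (L + (j - i)) - pump_limit \<alpha> e f i j =
      T (j - i) * (run_offset \<alpha> e f L - pump_limit \<alpha> e f i j)
      - (run_offset \<alpha> (del i j e) (del i j f) (L - (j - i)) - pump_limit \<alpha> e f i j)" (is ?del)
proof -
  let ?c = "pump_limit \<alpha> e f i j"
  have T3: "T (j - i) \<ge> 3" using T_ge_3[OF assms(3)] assms(1) by simp
  then have "(2 - real (T (j - i))) * ?c = pump_const f i j - \<alpha> * pump_const e i j"
    by (simp add: pump_limit_def)
  then show ?dup ?del
    using digit_value_dup_recurrence[OF assms, of e] digit_value_dup_recurrence[OF assms, of f]
      digit_value_del_recurrence[OF assms, of e] digit_value_del_recurrence[OF assms, of f]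
    unfolding run_offset_def by algebra+
qed

lemma pump_const_dup: "i \<le> j \<Longrightarrow> pump_const (dup i j e) i j = pump_const e i j"
  by (rule pump_const_cong) (simp_all add: dup_def)

text \<open>Repeated duplication yields accepting runs of growing length whose offsets all lie
  between \<open>\<beta> - 1\<close> and \<beta>. Boundedness leaves only the geometric solution of
  ratio \<open>m\<close>, which converges to \<open>c\<close>, so \<open>c\<close> lies between the
  same bounds.\<close>

lemma pumping:
  assumes sync: "synchronizes \<gamma> A (beatty \<alpha> \<beta>)" and run: "run A e f st L" "loop e f st L i j"
    and pos: "digit_value e L > 0"
  defines "c \<equiv> pump_limit \<alpha> e f i j" and "m \<equiv> \<mu> (j - i)"
  defines "w0 \<equiv> run_offset \<alpha> e f L"
    and "w1 \<equiv> run_offset \<alpha> (dup i j e) (dup i j f) (L + (j - i))"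
    and "w2 \<equiv> run_offset \<alpha> (dup i j (dup i j e)) (dup i j (dup i j f)) (L + (j - i) + (j - i))"
  shows "w1 - c = m * (w0 - c)" "w2 - c = m * (w1 - c)" "\<beta> - 1 \<le> c" "c \<le> \<beta>"
proof -
  define b where "b = j - i"
  have ij: "1 \<le> i" "i < j" "j < L" "N dvd b" "b > 0"
    using run(2) by (auto simp: loop_def b_def)
  define E F S where "E k = (dup i j ^^ k) e" and "F k = (dup i j ^^ k) f"
    and "S k = (dup i j ^^ k) st" for k
  define W where "W k = run_offset \<alpha> (E k) (F k) (L + k * b)" for k
  have ESuc: "E (Suc k) = dup i j (E k)" "F (Suc k) = dup i j (F k)" "S (Suc k) = dup i j (S k)"
    "L + Suc k * b = L + k * b + (j - i)" for k
    by (simp_all add: E_def F_def S_def b_def)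
  \<comment> \<open>Duplication leaves the digits and states below \<open>j\<close> unchanged, so
    the same \<open>i\<close> and \<open>j\<close> can be pumped again with the same limit.\<close>
  have runs: "run A (E k) (F k) (S k) (L + k * b) \<and> loop (E k) (F k) (S k) (L + k * b) i j \<and>
      digit_value (E k) (L + k * b) > 0 \<and> pump_limit \<alpha> (E k) (F k) i j = c" for k
  proof (induction k)
    case 0
    then show ?case using run pos by (simp add: E_def F_def S_def c_def)
  next
    case (Suc k)
    then have k: "run A (E k) (F k) (S k) (L + k * b)" "loop (E k) (F k) (S k) (L + k * b) i j"
      "digit_value (E k) (L + k * b) > 0" "pump_limit \<alpha> (E k) (F k) i j = c" by auto
    have "digit_value (E k) (L + k * b) \<le> digit_value (E (Suc k)) (L + Suc k * b)"
      unfolding ESuc using ij by (intro digit_value_dup_ge) auto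
    then have "digit_value (E (Suc k)) (L + Suc k * b) > 0" using k(3) by linarith
    moreover have "pump_limit \<alpha> (E (Suc k)) (F (Suc k)) i j = c"
      using k(4) ij by (simp add: ESuc pump_limit_def pump_const_dup)
    ultimately show ?case using run_dup[OF k(1,2)] loop_dup[OF k(2)] unfolding ESuc by blast
  qed
  have bounds: "\<beta> - 1 \<le> W k" "W k \<le> \<beta>" for k
    using run_offset_bounds[OF sync] runs[of k] unfolding W_def by blast+
  have m: "(T b - m) * m = 1" "0 < m" "m < 1"
    using T_mu[OF ij(4,5)] mu_pos[OF ij(4,5)] mu_less_half[OF ij(4,5)] by (auto simp: m_def b_def)
  have step: "W (Suc k) - c = m * (W k - c)" for k
  proof (rule bounded_linear_recurrence[where v = "\<lambda>k. W k - c" and t = "real (T b)"])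
    show "W (Suc (Suc k)) - c = real (T b) * (W (Suc k) - c) - (W k - c)" for k
    proof -
      have "j < L + k * b" "N dvd j - i" "pump_limit \<alpha> (E k) (F k) i j = c"
        using ij runs[of k] by (auto simp: b_def)
      then show ?thesis
        using run_offset_recurrence(1)[OF ij(2), of "L + k * b" \<alpha> "E k" "F k"]
        unfolding W_def ESuc b_def[symmetric] by simp
    qed
    show "\<bar>W k - c\<bar> \<le> \<bar>\<beta>\<bar> + 1 + \<bar>c\<bar>" for k using bounds[of k] by linarith
  qed (use m in auto)
  have w: "W 0 = w0" "W (Suc 0) = w1" "W (Suc (Suc 0)) = w2"
    unfolding W_def w0_def w1_def w2_def ESuc by (simp_all add: E_def F_def b_def)
  show "w1 - c = m * (w0 - c)" "w2 - c = m * (w1 - c)" using step[of 0] step[of 1] w by simp_all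
  have "c + m ^ k * (W 0 - c) = W k" for k
  proof (induction k)
    case (Suc k)
    have "c + m ^ Suc k * (W 0 - c) = c + m * ((c + m ^ k * (W 0 - c)) - c)" by simp
    also have "\<dots> = W (Suc k)" unfolding Suc using step[of k] by linarith
    finally show ?case .
  qed simp
  moreover have "(\<lambda>k. c + m ^ k * (W 0 - c)) \<longlonglongrightarrow> c + 0 * (W 0 - c)"
    using m by (intro tendsto_intros LIMSEQ_power_zero) auto
  ultimately have lim: "W \<longlonglongrightarrow> c" by simp
  show "\<beta> - 1 \<le> c" using lim bounds(1) by (intro LIMSEQ_le_const) auto
  show "c \<le> \<beta>" using lim bounds(2) by (intro LIMSEQ_le_const2) auto
qed

section \<open>Certificates\<close>

text \<open>Two geometric steps of the offsets, which are linear equations for \<alpha> and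
  \<open>v\<close>. They are solvable uniquely because the first two values of \<open>e\<close>
  differ and the ratio is irrational.\<close>

definition pump_equations ::
  "(nat \<Rightarrow> nat) \<Rightarrow> (nat \<Rightarrow> nat) \<Rightarrow> (nat \<Rightarrow> nat) \<Rightarrow> nat \<Rightarrow> nat \<Rightarrow> nat \<Rightarrow> real \<Rightarrow> real \<Rightarrow> bool" where
  "pump_equations e f st L i j \<alpha> v \<longleftrightarrow> loop e f st L i j \<and>
     digit_value e L > 0 \<and> digit_value (dup i j e) (L + (j - i)) \<noteq> digit_value e L \<and>
     run_offset \<alpha> (dup i j e) (dup i j f) (L + (j - i)) - v = \<mu> (j - i) * (run_offset \<alpha> e f L - v) \<and>
     run_offset \<alpha> (dup i j (dup i j e)) (dup i j (dup i j f)) (L + (j - i) + (j - i)) - v =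
       \<mu> (j - i) * (run_offset \<alpha> (dup i j e) (dup i j f) (L + (j - i)) - v)"

text \<open>By \<open>pumping\<close>, the true slope and the limit \<open>l\<close> of the loop
  satisfy the same equations as \<open>x\<close> and \<open>v\<close>. Eliminating the limits leaves
  \<open>x - \<alpha>\<close> times a nonzero factor; then \<open>v = l\<close>, which inherits the
  bounds.\<close>

lemma certificate_sound:
  assumes sync: "synchronizes \<gamma> A (beatty \<alpha> \<beta>)" and run: "run A e f st L" and cert: "pump_equations e f st L i j x v"
  shows "x = \<alpha>" "\<beta> - 1 \<le> v" "v \<le> \<beta>"
proof -
  note c = cert[unfolded pump_equations_def]
  then have run: "run A e f st L" "loop e f st L i j" "digit_value e L > 0" using run by auto
  define b m where "b = j - i" and "m = \<mu> b"
  have b: "N dvd b" "b > 0" using run(2) by (auto simp: loop_def b_def)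
  have m: "m \<noteq> 1" using mu_less_half[OF b] by (auto simp: m_def)
  define V0 V1 V2 where "V0 = real (digit_value e L)"
    and "V1 = real (digit_value (dup i j e) (L + b))"
    and "V2 = real (digit_value (dup i j (dup i j e)) (L + b + b))"
  define Y0 Y1 Y2 where "Y0 = real (digit_value f L)"
    and "Y1 = real (digit_value (dup i j f) (L + b))"
    and "Y2 = real (digit_value (dup i j (dup i j f)) (L + b + b))"
  note defs = V0_def[symmetric] V1_def[symmetric] V2_def[symmetric] Y0_def[symmetric]
    Y1_def[symmetric] Y2_def[symmetric] m_def[symmetric]
  have x: "Y1 - x * V1 - v = m * (Y0 - x * V0 - v)" "Y2 - x * V2 - v = m * (Y1 - x * V1 - v)"
    using c unfolding run_offset_def b_def[symmetric] defs by auto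
  define l where "l = pump_limit \<alpha> e f i j"
  note pump = pumping[OF sync run, folded l_def, unfolded run_offset_def, folded b_def, unfolded defs]
  have "(x - \<alpha>) * ((V2 - V1) - m * (V1 - V0)) = 0" using x pump(1,2) by algebra
  moreover have "(V2 - V1) - m * (V1 - V0) \<noteq> 0"
    unfolding V0_def V1_def V2_def m_def using b c by (intro mu_diff_neq_0) (auto simp: b_def)
  ultimately show xa: "x = \<alpha>" by simp
  have "(v - l) * (m - 1) = 0" using x(1) pump(1) unfolding xa by algebra
  then have "v = l" using m by simp
  then show "\<beta> - 1 \<le> v" "v \<le> \<beta>" using pump(3,4) by auto
qed

text \<open>Pigeonhole on the transitions at the positions \<open>t * N\<close>. Sampling
  transitions instead of states also equates the digits below the seam, and the spacing
  \<open>N\<close> gives the divisibility. The loop boundaries are \<open>Suc (t * N)\<close>, hence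
  at least 1.\<close>

lemma loop_exists:
  assumes run: "run A e f st L" and K: "K = Suc (card (set (transitions A)) * N)" "K < L"
  obtains i j where "loop e f st L i j" "j \<le> K"
proof -
  let ?M = "card (set (transitions A))"
  define tr where "tr t = (st (Suc (t * N)), (e (t * N), f (t * N)), st (t * N))" for t
  have "tr ` {..?M} \<subseteq> set (transitions A)"
  proof
    fix y assume "y \<in> tr ` {..?M}"
    then obtain t where t: "t \<le> ?M" "y = tr t" by auto
    then have "t * N \<le> ?M * N" by simp
    then have "t * N < L" using K by linarith
    then show "y \<in> set (transitions A)" using run t by (simp add: run_def tr_def)
  qed
  then have "card (tr ` {..?M}) \<le> ?M" by (intro card_mono) auto
  then have "\<not> inj_on tr {..?M}" using card_image[of tr "{..?M}"] by fastforce
  then obtain s t where st: "s < t" "t \<le> ?M" "tr s = tr t"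
    unfolding inj_on_def by (metis atMost_iff linorder_neq_iff)
  have "t * N \<le> ?M * N" using st(2) by (rule mult_le_mono1)
  then have "Suc (t * N) \<le> K" "Suc (t * N) < L" using K by linarith+
  moreover have "s * N < t * N" using st N_pos by simp
  moreover have "N dvd Suc (t * N) - Suc (s * N)" by (simp flip: diff_mult_distrib)
  ultimately show ?thesis using st(3) K
    by (intro that[of "Suc (s * N)" "Suc (t * N)"]) (auto simp: loop_def tr_def)
qed

text \<open>A limit depends only on \<open>i\<close>, \<open>j\<close> and the digits below
  \<open>j\<close>, that is, on a list of length at most \<open>K\<close> over
  \<open>D\<close>.\<close>

lemma finite_pump_limits:
  assumes "finite D"
  shows "finite {pump_limit \<alpha> e f i j | e f i j. i \<le> j \<and> j \<le> K \<and> (\<forall>k<j. (e k, f k) \<in> D)}"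
proof (rule finite_subset)
  let ?G = "\<lambda>(ds, i, j). pump_limit \<alpha> (\<lambda>k. fst (ds ! k)) (\<lambda>k. snd (ds ! k)) i j"
  let ?S = "{ds. set ds \<subseteq> D \<and> length ds \<le> K} \<times> {..K} \<times> {..K}"
  show "finite (?G ` ?S)" using assms by (intro finite_imageI finite_cartesian_product finite_lists_length_le) auto
  show "{pump_limit \<alpha> e f i j | e f i j. i \<le> j \<and> j \<le> K \<and> (\<forall>k<j. (e k, f k) \<in> D)} \<subseteq> ?G ` ?S"
  proof
    fix y assume "y \<in> {pump_limit \<alpha> e f i j | e f i j. i \<le> j \<and> j \<le> K \<and> (\<forall>k<j. (e k, f k) \<in> D)}"
    then obtain e f i j where y: "y = pump_limit \<alpha> e f i j" "i \<le> j" "j \<le> K" "\<forall>k<j. (e k, f k) \<in> D"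
      by blast
    let ?ds = "map (\<lambda>k. (e k, f k)) [0..<j]"
    have "pump_const e i j = pump_const (\<lambda>k. fst (?ds ! k)) i j"
      "pump_const f i j = pump_const (\<lambda>k. snd (?ds ! k)) i j"
      using y(2) by (auto intro!: pump_const_cong)
    then have "y = ?G (?ds, i, j)" unfolding y(1) pump_limit_def by simp
    moreover have "(?ds, i, j) \<in> ?S" using y by auto
    ultimately show "y \<in> ?G ` ?S" by (rule image_eqI)
  qed
qed

lemma near_pump_limit:
  assumes sync: "synchronizes \<gamma> A (beatty \<alpha> \<beta>)" and irr: "\<alpha> \<notin> \<rat>"
    and v: "v = \<beta> \<or> v = \<beta> - 1" and \<epsilon>: "\<epsilon> > 0"
  defines "K \<equiv> Suc (card (set (transitions A)) * N)"
  obtains c d r L i j where "run A (list_nth c) (list_nth d) (list_nth r) L"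
    "loop (list_nth c) (list_nth d) (list_nth r) L i j" "j \<le> K" "digit_value (list_nth c) L > 0"
    "digit_value (dup i j (list_nth c)) (L + (j - i)) \<noteq> digit_value (list_nth c) L"
    "\<bar>pump_limit \<alpha> (list_nth c) (list_nth d) i j - v\<bar> < \<epsilon>"
proof -
  \<comment> \<open>\<open>n \<ge> q K\<close> forces the run to be longer than \<open>K\<close> and
    to have a nonzero digit of \<open>e\<close> at or above \<open>j\<close>.\<close>
  obtain n where n: "n \<ge> q K" "n > 0" "\<bar>of_int (beatty \<alpha> \<beta> n) - real n * \<alpha> - v\<bar> < \<epsilon> / 2"
    using beatty_near_bounds[OF irr _ v, of "\<epsilon> / 2" "q K"] \<epsilon> by auto
  obtain c' d' r' L where run':
    "run A (list_nth c') (list_nth d') (list_nth r') L" "digit_value (list_nth c') L = n"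
    using run_exists[OF sync n(2)] by metis
  define e f st where "e = list_nth c'" and "f = list_nth d'" and "st = list_nth r'"
  note run = run'[folded e_def f_def st_def]
  have pos: "digit_value e L > 0" using run n by simp
  have d: "ostrowski_digits e L" using run(1) by (simp add: run_def)
  have "K < L"
  proof (rule ccontr)
    assume "\<not> K < L"
    then have "q L \<le> q K" by (intro q_mono) auto
    then show False using digit_value_less[OF d] run n by linarith
  qed
  from loop_exists[OF run(1) _ this] obtain i j where loop: "loop e f st L i j" "j \<le> K"
    unfolding K_def by blast
  then have ij: "1 \<le> i" "i < j" "j < L" "N dvd j - i" "j - i > 0" by (auto simp: loop_def)
  have high: "\<exists>k<L. j \<le> k \<and> e k > 0"
  proof (rule ccontr)
    assume z: "\<not> (\<exists>k<L. j \<le> k \<and> e k > 0)"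
    have "digit_value e L = digit_value e j"
      unfolding digit_value_def using z ij by (intro sum.mono_neutral_right) auto
    also have "\<dots> < q j" using ostrowski_digits_mono[OF d] ij by (intro digit_value_less) auto
    also have "\<dots> \<le> q K" using loop by (intro q_mono)
    finally show False using run n by simp
  qed
  define c where "c = pump_limit \<alpha> e f i j"
  define m where "m = \<mu> (j - i)"
  define w w0 where "w = run_offset \<alpha> e f L"
    and "w0 = run_offset \<alpha> (del i j e) (del i j f) (L - (j - i))"
  have m: "(T (j - i) - m) * m = 1" "0 < m" "m < 1 / 2"
    using T_mu[OF ij(4,5)] mu_pos[OF ij(4,5)] mu_less_half[OF ij(4,5)] by (auto simp: m_def)
  have w: "\<bar>w - v\<bar> < \<epsilon> / 2"
    using run_value[OF sync run(1) pos] n(3) run(2) by (simp add: w_def run_offset_def mult.commute)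
  \<comment> \<open>The shortened word must have positive value, as its offset is bounded only
    then.\<close>
  have delpos: "digit_value (del i j e) (L - (j - i)) > 0"
  proof -
    obtain k where k: "k < L" "j \<le> k" "e k > 0" using high by blast
    then have "k - (j - i) \<in> {..<L - (j - i)}" "del i j e (k - (j - i)) = e k"
      using ij by (auto simp: del_def)
    then show ?thesis unfolding digit_value_def using k q_pos[of "k - (j - i)"]
      by (intro sum_pos2[where i = "k - (j - i)"]) auto
  qed
  have bw: "\<beta> - 1 \<le> w" "w \<le> \<beta>" using run_offset_bounds[OF sync run(1) pos] by (simp_all add: w_def)
  have bw0: "\<beta> - 1 \<le> w0" "w0 \<le> \<beta>"
    using run_offset_bounds[OF sync run_del[OF run(1) loop(1)] delpos] by (simp_all add: w0_def)
  have pump: "run_offset \<alpha> (dup i j e) (dup i j f) (L + (j - i)) - c = m * (w - c)" "\<beta> - 1 \<le> c" "c \<le> \<beta>"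
    using pumping[OF sync run(1) loop(1) pos] by (auto simp: c_def m_def w_def)
  have "w0 - c = (T (j - i) - m) * (w - c)"
    using run_offset_recurrence(2)[OF ij(2,3,4), of \<alpha> e f] pump(1)
    by (simp add: c_def w_def w0_def algebra_simps)
  then have "m * (w0 - c) = ((T (j - i) - m) * m) * (w - c)" by (simp only: ac_simps)
  then have w0: "m * (w0 - c) = w - c" using m(1) by simp
  \<comment> \<open>\<open>w = (1 - m) * c + m * w0\<close> is a convex combination of two points
    between \<open>\<beta> - 1\<close> and \<beta>. As \<open>v\<close> is one of these endpoints,
    \<open>(1 - m) * \<bar>c - v\<bar> \<le> \<bar>w - v\<bar>\<close>, and
    \<open>1 - m > 1 / 2\<close>.\<close>
  have "\<bar>c - v\<bar> \<le> 2 * \<bar>w - v\<bar>"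
  proof (cases "v = \<beta>")
    case True
    have "m * (\<beta> - w0) \<ge> 0" using m bw0 by simp
    then have "(1 - m) * (\<beta> - c) \<le> \<beta> - w" using w0 by (simp add: algebra_simps)
    moreover have "1 / 2 * (\<beta> - c) \<le> (1 - m) * (\<beta> - c)"
      using m pump by (intro mult_right_mono) auto
    ultimately show ?thesis using True pump bw by auto
  next
    case False
    then have v': "v = \<beta> - 1" using v by simp
    have "m * (w0 - v) \<ge> 0" using m bw0 v' by simp
    then have "(1 - m) * (c - v) \<le> w - v" using w0 by (simp add: algebra_simps)
    moreover have "1 / 2 * (c - v) \<le> (1 - m) * (c - v)"
      using m pump v' by (intro mult_right_mono) auto
    ultimately show ?thesis using v' pump bw by auto
  qed
  also have "2 * \<bar>w - v\<bar> < \<epsilon>" using w by simp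
  finally have "\<bar>c - v\<bar> < \<epsilon>" .
  then show ?thesis
    using that[OF run'(1), folded e_def f_def st_def, OF loop pos]
      digit_value_dup_ge(2)[OF ij(1,2,3) high] by (simp add: c_def)
qed

text \<open>Near-extremal \<open>n\<close> have pumping limits near the extremal value; these limits only depend on
  boundedly many digits, so the extremal value itself is one of them.\<close>

lemma certificate_complete:
  assumes sync: "synchronizes \<gamma> A (beatty \<alpha> \<beta>)" and irr: "\<alpha> \<notin> \<rat>"
    and v: "v = \<beta> \<or> v = \<beta> - 1"
  obtains c d r L i j where "run A (list_nth c) (list_nth d) (list_nth r) L"
    "pump_equations (list_nth c) (list_nth d) (list_nth r) L i j \<alpha> v"
proof -
  define K where "K = Suc (card (set (transitions A)) * N)"
  define P where "P x c d r L i j \<longleftrightarrow> run A (list_nth c) (list_nth d) (list_nth r) L \<and>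
      loop (list_nth c) (list_nth d) (list_nth r) L i j \<and> j \<le> K \<and> digit_value (list_nth c) L > 0 \<and>
      digit_value (dup i j (list_nth c)) (L + (j - i)) \<noteq> digit_value (list_nth c) L \<and>
      x = pump_limit \<alpha> (list_nth c) (list_nth d) i j"
    for x c d r L i j
  define X where "X = {x. \<exists>c d r L i j. P x c d r L i j}"
  \<comment> \<open>Every digit pair of a run labels a transition, so only finitely many pairs
    occur.\<close>
  let ?D = "(\<lambda>(_, d, _). d) ` set (transitions A)"
  have "X \<subseteq> {pump_limit \<alpha> e f i j | e f i j. i \<le> j \<and> j \<le> K \<and> (\<forall>k<j. (e k, f k) \<in> ?D)}"
  proof
    fix x assume "x \<in> X"
    then obtain c d r L i j where x: "P x c d r L i j" unfolding X_def by blast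
    have "(list_nth c k, list_nth d k) \<in> ?D" if "k < j" for k
    proof -
      have "(list_nth r (Suc k), (list_nth c k, list_nth d k), list_nth r k) \<in> set (transitions A)"
        using x that by (auto simp: P_def run_def loop_def)
      then show ?thesis by force
    qed
    moreover have "i \<le> j" "j \<le> K" "x = pump_limit \<alpha> (list_nth c) (list_nth d) i j"
      using x by (auto simp: P_def loop_def)
    ultimately show "x \<in> {pump_limit \<alpha> e f i j | e f i j. i \<le> j \<and> j \<le> K \<and> (\<forall>k<j. (e k, f k) \<in> ?D)}"
      by blast
  qed
  then have "finite X" by (rule finite_subset) (intro finite_pump_limits finite_imageI finite_set)
  then have "closed X" by (rule finite_imp_closed)
  moreover have "v \<in> closure X"
    unfolding closure_approachable
  proof (intro allI impI)
    fix \<epsilon> :: real assume "\<epsilon> > 0"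
    from near_pump_limit[OF sync irr v this] obtain c d r L i j where
      "P (pump_limit \<alpha> (list_nth c) (list_nth d) i j) c d r L i j"
      "\<bar>pump_limit \<alpha> (list_nth c) (list_nth d) i j - v\<bar> < \<epsilon>"
      unfolding P_def K_def by metis
    then show "\<exists>x\<in>X. dist x v < \<epsilon>" unfolding X_def dist_real_def by blast
  qed
  ultimately have "v \<in> X" by simp
  then obtain c d r L i j where "P v c d r L i j" unfolding X_def by blast
  then show ?thesis
    using pumping[OF sync, of "list_nth c" "list_nth d" "list_nth r" L i j] that[of c d r L i j]
    unfolding P_def pump_equations_def by auto
qed

end

section \<open>The field generated by \<open>\<gamma>\<close>\<close>

lemma real_subfield_Rats:
  assumes "real_subfield K" shows "\<rat> \<subseteq> K"
proof
  have K: "0 \<in> K" "1 \<in> K" "\<And>x y. x \<in> K \<Longrightarrow> y \<in> K \<Longrightarrow> x + y \<in> K"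
    "\<And>x y. x \<in> K \<Longrightarrow> y \<in> K \<Longrightarrow> x - y \<in> K" "\<And>x y. x \<in> K \<Longrightarrow> y \<in> K \<Longrightarrow> x * y \<in> K"
    "\<And>x. x \<in> K \<Longrightarrow> x \<noteq> 0 \<Longrightarrow> inverse x \<in> K"
    using assms unfolding real_subfield_def by blast+
  have nat: "real n \<in> K" for n by (induction n) (auto intro: K)
  have int: "real_of_int z \<in> K" for z
    using nat[of "nat z"] K(4)[OF K(1) nat[of "nat (- z)"]] by (cases "z \<ge> 0") auto
  fix x :: real assume "x \<in> \<rat>"
  then obtain i n where "n \<noteq> 0" "x = real_of_int i / real_of_int n"
    by (metis Rats_cases' less_irrefl)
  then show "x \<in> K" using K(5)[OF int[of i] K(6)[OF int[of n]]] by (simp add: divide_inverse)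
qed

lemma lin_comb_decode_rat_adjoin: "lin_comb_decode \<gamma> u \<in> rat_adjoin \<gamma>"
  unfolding rat_adjoin_def
proof (rule InterI)
  fix K assume "K \<in> {K. real_subfield K \<and> \<gamma> \<in> K}"
  then have K: "real_subfield K" "\<gamma> \<in> K" by auto
  have "real_of_rat r \<in> K" for r using real_subfield_Rats[OF K(1)] by auto
  then show "lin_comb_decode \<gamma> u \<in> K"
    using K unfolding lin_comb_decode_def real_subfield_def by (auto split: prod.split)
qed

lemma rat_decode_surj: "\<exists>c. rat_decode c = r"
proof -
  obtain x y where xy: "quotient_of r = (x, y)" by force
  then have "y > 0" "r = of_int x / of_int y"
    by (auto intro: quotient_of_denom_pos quotient_of_div)
  then have "rat_decode (prod_encode (int_encode x, nat y)) = r" by (simp add: rat_decode_def)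
  then show ?thesis by blast
qed

context periodic_cf
begin

text \<open>As \<gamma> is quadratic, this set is closed under products and inverses, so linear
  equations over it have their solutions in it.\<close>

definition rational_combinations :: "real set" where
  "rational_combinations = {r + s * \<gamma> | r s. r \<in> \<rat> \<and> s \<in> \<rat>}"

lemma rational_combinations_decode:
  assumes "x \<in> rational_combinations" obtains u where "lin_comb_decode \<gamma> u = x"
proof -
  obtain r s :: rat where "x = of_rat r + of_rat s * \<gamma>"
    using assms unfolding rational_combinations_def Rats_def by blast
  moreover obtain c d where "rat_decode c = r" "rat_decode d = s" using rat_decode_surj by metis
  ultimately have "lin_comb_decode \<gamma> (prod_encode (c, d)) = x" by (simp add: lin_comb_decode_def)
  then show ?thesis by (rule that)
qed

lemma gamma_square:
  "real (q (N - 1)) * \<gamma>\<^sup>2 = real (p N) + (real (p (N - 1)) - real (q N)) * \<gamma>"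
  using quadratic_equation[OF dvd_refl N_pos] by (simp add: \<mu>_def power2_eq_square algebra_simps)

lemma gamma_square_Rats:
  obtains g0 g1 where "g0 \<in> \<rat>" "g1 \<in> \<rat>" "\<gamma>\<^sup>2 = g0 + g1 * \<gamma>"
proof
  show "\<gamma>\<^sup>2 = real (p N) / real (q (N - 1)) + (real (p (N - 1)) - real (q N)) / real (q (N - 1)) * \<gamma>"
    using gamma_square q_pos[of "N - 1"] by (simp add: field_simps)
qed auto

lemma Rats_combination_eq_0: "r \<in> \<rat> \<Longrightarrow> s \<in> \<rat> \<Longrightarrow> r + s * \<gamma> = 0 \<Longrightarrow> r = 0 \<and> s = 0"
proof -
  assume rs: "r \<in> \<rat>" "s \<in> \<rat>" and eq: "r + s * \<gamma> = 0"
  have "s = 0"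
  proof (rule ccontr)
    assume "s \<noteq> 0"
    then have "\<gamma> = - r / s" using eq by (simp add: field_simps)
    then show False using gamma_irrational rs by auto
  qed
  then show ?thesis using eq by simp
qed

lemma rational_combinations_diff:
  assumes "x \<in> rational_combinations" "y \<in> rational_combinations"
  shows "x - y \<in> rational_combinations"
proof -
  obtain r s r' s' where "x = r + s * \<gamma>" "y = r' + s' * \<gamma>" "r \<in> \<rat>" "s \<in> \<rat>" "r' \<in> \<rat>" "s' \<in> \<rat>"
    using assms unfolding rational_combinations_def by blast
  then show ?thesis unfolding rational_combinations_def
    by (intro CollectI exI[of _ "r - r'"] exI[of _ "s - s'"]) (auto simp: algebra_simps)
qed

lemma rational_combinations_mult:
  assumes "x \<in> rational_combinations" "y \<in> rational_combinations"
  shows "x * y \<in> rational_combinations"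
proof -
  obtain r s r' s' where xy: "x = r + s * \<gamma>" "y = r' + s' * \<gamma>" "r \<in> \<rat>" "s \<in> \<rat>" "r' \<in> \<rat>" "s' \<in> \<rat>"
    using assms unfolding rational_combinations_def by blast
  obtain g0 g1 where g: "g0 \<in> \<rat>" "g1 \<in> \<rat>" "\<gamma>\<^sup>2 = g0 + g1 * \<gamma>" by (rule gamma_square_Rats)
  have "x * y = (r * r' + s * s' * g0) + (r * s' + s * r' + s * s' * g1) * \<gamma>"
    using g(3) unfolding xy by algebra
  moreover have "r * r' + s * s' * g0 \<in> \<rat>" "r * s' + s * r' + s * s' * g1 \<in> \<rat>"
    using xy g by simp_all
  ultimately show ?thesis unfolding rational_combinations_def by blast
qed

lemma rational_combinations_inverse:
  assumes "x \<in> rational_combinations" shows "inverse x \<in> rational_combinations"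
proof (cases "x = 0")
  case False
  obtain r s where x: "x = r + s * \<gamma>" "r \<in> \<rat>" "s \<in> \<rat>"
    using assms unfolding rational_combinations_def by blast
  obtain g0 g1 where g: "g0 \<in> \<rat>" "g1 \<in> \<rat>" "\<gamma>\<^sup>2 = g0 + g1 * \<gamma>" by (rule gamma_square_Rats)
  \<comment> \<open>\<open>y\<close> is the conjugate of \<open>x\<close>, with \<gamma> replaced by
    \<open>g1 - \<gamma>\<close>, and \<open>n\<close> is the norm.\<close>
  define y n where "y = (r + s * g1) + (- s) * \<gamma>" and "n = r * r + r * s * g1 - s * s * g0"
  have xy: "x * y = n" using g(3) unfolding x y_def n_def by algebra
  have "y \<noteq> 0"
  proof
    assume "y = 0"
    then have "r + s * g1 = 0 \<and> - s = 0"
      unfolding y_def by (rule Rats_combination_eq_0[rotated 2]) (use x g in auto)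
    then show False using False x by auto
  qed
  then have "n \<noteq> 0" using xy False by auto
  then have "inverse x = y / n" using xy False by (simp add: field_simps)
  then have "inverse x = (r + s * g1) / n + (- s / n) * \<gamma>" by (simp add: y_def add_divide_distrib diff_divide_distrib)
  moreover have "n \<in> \<rat>" using x g by (simp add: n_def)
  then have "(r + s * g1) / n \<in> \<rat>" "- s / n \<in> \<rat>" using x g by simp_all
  ultimately show ?thesis unfolding rational_combinations_def by blast
qed (use assms in simp)

lemma rational_combinations_of_nat: "real n \<in> rational_combinations"
  unfolding rational_combinations_def by (intro CollectI exI[of _ "real n"] exI[of _ 0]) auto

lemma mu_rational_combinations: "\<mu> b \<in> rational_combinations"
  unfolding rational_combinations_def \<mu>_def
  by (intro CollectI exI[of _ "real (p (b - 1))"] exI[of _ "- real (q (b - 1))"]) auto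

lemmas rational_combinations_intros =
  rational_combinations_diff rational_combinations_mult rational_combinations_inverse
  rational_combinations_of_nat mu_rational_combinations

text \<open>Eliminating \<open>v\<close> from the two equations gives \<alpha> as a quotient of
  expressions in \<open>\<mu> b\<close> and natural numbers; the first equation then gives
  \<open>v\<close>.\<close>

lemma pump_equations_rational:
  assumes "pump_equations e f st L i j \<alpha> v"
  shows "\<alpha> \<in> rational_combinations" "v \<in> rational_combinations"
proof -
  note c = assms[unfolded pump_equations_def]
  define b m where "b = j - i" and "m = \<mu> b"
  have b: "N dvd b" "b > 0" using c by (auto simp: loop_def b_def)
  have m: "m \<noteq> 1" using mu_less_half[OF b] by (auto simp: m_def)
  define V0 V1 V2 where "V0 = real (digit_value e L)"
    and "V1 = real (digit_value (dup i j e) (L + b))"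
    and "V2 = real (digit_value (dup i j (dup i j e)) (L + b + b))"
  define Y0 Y1 Y2 where "Y0 = real (digit_value f L)"
    and "Y1 = real (digit_value (dup i j f) (L + b))"
    and "Y2 = real (digit_value (dup i j (dup i j f)) (L + b + b))"
  note defs = V0_def[symmetric] V1_def[symmetric] V2_def[symmetric] Y0_def[symmetric]
    Y1_def[symmetric] Y2_def[symmetric] m_def[symmetric]
  have x: "Y1 - \<alpha> * V1 - v = m * (Y0 - \<alpha> * V0 - v)" "Y2 - \<alpha> * V2 - v = m * (Y1 - \<alpha> * V1 - v)"
    using c unfolding run_offset_def b_def[symmetric] defs by auto
  have nz: "(V2 - V1) - m * (V1 - V0) \<noteq> 0"
    unfolding V0_def V1_def V2_def m_def using b c by (intro mu_diff_neq_0) (auto simp: b_def)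
  have "((Y2 - Y1) - m * (Y1 - Y0)) = \<alpha> * ((V2 - V1) - m * (V1 - V0))" using x by algebra
  then have "\<alpha> = ((Y2 - Y1) - m * (Y1 - Y0)) * inverse ((V2 - V1) - m * (V1 - V0))"
    using nz by (simp add: field_simps)
  moreover have "((Y2 - Y1) - m * (Y1 - Y0)) * inverse ((V2 - V1) - m * (V1 - V0)) \<in> rational_combinations"
    unfolding V0_def V1_def V2_def Y0_def Y1_def Y2_def m_def by (intro rational_combinations_intros)
  ultimately show \<alpha>: "\<alpha> \<in> rational_combinations" by simp
  have "v * (real 1 - m) = (Y1 - \<alpha> * V1) - m * (Y0 - \<alpha> * V0)" using x by (simp add: algebra_simps)
  then have "v = ((Y1 - \<alpha> * V1) - m * (Y0 - \<alpha> * V0)) * inverse (real 1 - m)"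
    using m by (simp add: field_simps)
  moreover have "((Y1 - \<alpha> * V1) - m * (Y0 - \<alpha> * V0)) * inverse (real 1 - m) \<in> rational_combinations"
    unfolding V0_def V1_def Y0_def Y1_def m_def by (intro rational_combinations_intros \<alpha>)
  ultimately show "v \<in> rational_combinations" by simp
qed

section \<open>Decidability of certificates\<close>

text \<open>A computable sequence in the field of \<gamma>, with integer coefficients over a common
  denominator. Since 1 and \<gamma> are linearly independent over the rationals, equality of such
  sequences reduces to equality of integers.\<close>

definition field_recursive :: "(nat \<Rightarrow> real) \<Rightarrow> bool" where
  "field_recursive f \<longleftrightarrow> (\<exists>A B D. int_recursive A \<and> int_recursive B \<and> int_recursive D \<and>
     (\<forall>x. D x \<noteq> 0 \<and> f x * of_int (D x) = of_int (A x) + of_int (B x) * \<gamma>))"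

lemma field_recursiveI:
  assumes "int_recursive A" "int_recursive B" "int_recursive D" "\<And>x. D x \<noteq> 0"
    "\<And>x. f x * of_int (D x) = of_int (A x) + of_int (B x) * \<gamma>"
  shows "field_recursive f"
  using assms unfolding field_recursive_def by blast

lemma field_recursive_of_nat [recursive_intros]: "recursive f \<Longrightarrow> field_recursive (\<lambda>x. real (f x))"
  by (rule field_recursiveI[of "\<lambda>x. int (f x)" "\<lambda>_. 0" "\<lambda>_. 1"]) (auto intro: recursive_intros)

lemma field_recursive_gamma [recursive_intros]: "field_recursive (\<lambda>_. \<gamma>)"
  by (rule field_recursiveI[of "\<lambda>_. 0" "\<lambda>_. 1" "\<lambda>_. 1"]) (auto intro: recursive_intros)

lemma field_recursive_one [recursive_intros]: "field_recursive (\<lambda>_. 1)"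
  using field_recursive_of_nat[OF recursive_const[of 1]] by simp

lemma field_recursive_diff [recursive_intros]:
  assumes "field_recursive f" "field_recursive g" shows "field_recursive (\<lambda>x. f x - g x)"
proof -
  obtain A B D where r: "int_recursive A" "int_recursive B" "int_recursive D"
    and f: "\<And>x. D x \<noteq> 0" "\<And>x. f x * of_int (D x) = of_int (A x) + of_int (B x) * \<gamma>"
    using assms(1) unfolding field_recursive_def by blast
  obtain A' B' D' where r': "int_recursive A'" "int_recursive B'" "int_recursive D'"
    and g: "\<And>x. D' x \<noteq> 0" "\<And>x. g x * of_int (D' x) = of_int (A' x) + of_int (B' x) * \<gamma>"
    using assms(2) unfolding field_recursive_def by blast
  show ?thesis
  proof (rule field_recursiveI[of "\<lambda>x. A x * D' x - A' x * D x" "\<lambda>x. B x * D' x - B' x * D x"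
        "\<lambda>x. D x * D' x"])
    show "(f x - g x) * of_int (D x * D' x) =
        of_int (A x * D' x - A' x * D x) + of_int (B x * D' x - B' x * D x) * \<gamma>" for x
      using f(2)[of x] g(2)[of x] unfolding of_int_mult of_int_diff by algebra
  qed (use r r' f(1) g(1) in \<open>auto intro!: recursive_intros\<close>)
qed

lemma field_recursive_mult [recursive_intros]:
  assumes "field_recursive f" "field_recursive g" shows "field_recursive (\<lambda>x. f x * g x)"
proof -
  obtain A B D where r: "int_recursive A" "int_recursive B" "int_recursive D"
    and f: "\<And>x. D x \<noteq> 0" "\<And>x. f x * of_int (D x) = of_int (A x) + of_int (B x) * \<gamma>"
    using assms(1) unfolding field_recursive_def by blast
  obtain A' B' D' where r': "int_recursive A'" "int_recursive B'" "int_recursive D'"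
    and g: "\<And>x. D' x \<noteq> 0" "\<And>x. g x * of_int (D' x) = of_int (A' x) + of_int (B' x) * \<gamma>"
    using assms(2) unfolding field_recursive_def by blast
  \<comment> \<open>The integral quadratic equation of \<gamma> reduces products; its leading
    coefficient \<open>G\<close> becomes a factor of the denominator.\<close>
  define G G0 G1 :: int where "G = int (q (N - 1))" and "G0 = int (p N)"
    and "G1 = int (p (N - 1)) - int (q N)"
  have G: "G \<noteq> 0" "of_int G * \<gamma>\<^sup>2 = of_int G0 + of_int G1 * \<gamma>"
    using q_pos[of "N - 1"] gamma_square by (simp_all add: G_def G0_def G1_def)
  show ?thesis
  proof (rule field_recursiveI[of "\<lambda>x. G * (A x * A' x) + B x * B' x * G0"
        "\<lambda>x. G * (A x * B' x + B x * A' x) + B x * B' x * G1" "\<lambda>x. G * (D x * D' x)"])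
    show "f x * g x * of_int (G * (D x * D' x)) = of_int (G * (A x * A' x) + B x * B' x * G0) +
        of_int (G * (A x * B' x + B x * A' x) + B x * B' x * G1) * \<gamma>" for x
      using f(2)[of x] g(2)[of x] G(2) unfolding of_int_mult of_int_add by algebra
  qed (use r r' f(1) g(1) G(1) in \<open>auto intro!: recursive_intros\<close>)
qed

lemma field_recursive_add [recursive_intros]:
  assumes "field_recursive f" "field_recursive g" shows "field_recursive (\<lambda>x. f x + g x)"
  using field_recursive_diff[OF assms(1) field_recursive_diff[OF field_recursive_of_nat[OF recursive_const[of 0]] assms(2)]]
  by simp

lemma decidable_field_eq [recursive_intros]:
  assumes "field_recursive f" "field_recursive g" shows "decidable (\<lambda>x. f x = g x)"
proof -
  obtain A B D where r: "int_recursive A" "int_recursive B" "int_recursive D"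
    and f: "\<And>x. D x \<noteq> 0" "\<And>x. (f x - g x) * of_int (D x) = of_int (A x) + of_int (B x) * \<gamma>"
    using field_recursive_diff[OF assms] unfolding field_recursive_def by blast
  have "f x = g x \<longleftrightarrow> A x = 0 \<and> B x = 0" for x
  proof
    assume "f x = g x"
    then have "of_int (A x) + of_int (B x) * \<gamma> = 0" using f(2)[of x] by simp
    then show "A x = 0 \<and> B x = 0"
      using Rats_combination_eq_0[of "of_int (A x)" "of_int (B x)"] by simp
  next
    assume "A x = 0 \<and> B x = 0"
    then show "f x = g x" using f[of x] by simp
  qed
  then show ?thesis using r by (simp add: recursive_intros)
qed

text \<open>A code with denominator 0 decodes to 0, which is represented with numerator 0 and
  denominator 1.\<close>

lemma field_recursive_rat_decode [recursive_intros]: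
  assumes "recursive f" shows "field_recursive (\<lambda>x. of_rat (rat_decode (f x)))"
proof (rule field_recursiveI[of "\<lambda>x. int (of_bool (psnd (f x) \<noteq> 0)) * int_decode (pfst (f x))"
      "\<lambda>_. 0" "\<lambda>x. int (if psnd (f x) = 0 then 1 else psnd (f x))"])
  show "of_rat (rat_decode (f x)) * of_int (int (if psnd (f x) = 0 then 1 else psnd (f x))) =
      of_int (int (of_bool (psnd (f x) \<noteq> 0)) * int_decode (pfst (f x))) + of_int 0 * \<gamma>" for x
    by (simp add: rat_decode_def pfst_def psnd_def split_beta of_rat_divide)
  show "int_recursive (\<lambda>x. int (of_bool (psnd (f x) \<noteq> 0)) * int_decode (pfst (f x)))"
    by (intro recursive_intros assms)
qed (use assms in \<open>auto intro!: recursive_intros\<close>)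

lemma field_recursive_lin_comb_decode [recursive_intros]:
  assumes "recursive f" shows "field_recursive (\<lambda>x. lin_comb_decode \<gamma> (f x))"
proof -
  have "lin_comb_decode \<gamma> u = of_rat (rat_decode (pfst u)) + of_rat (rat_decode (psnd u)) * \<gamma>" for u
    by (simp add: lin_comb_decode_def pfst_def psnd_def split_beta)
  then show ?thesis using assms by (simp add: recursive_intros)
qed

text \<open>Periodicity reduces the digits to a finite table. It starts at index 1, since the digit
  at index 0 does not belong to the period.\<close>

lemma recursive_a [recursive_intros]: "recursive f \<Longrightarrow> recursive (\<lambda>x. a (Suc (f x)))"
  by (rule recursive_periodic[OF _ N_pos, of f "\<lambda>i. a (Suc i)"]) (use digit_periodic in auto)

lemma recursive_q [recursive_intros]:
  assumes "recursive f" shows "recursive (\<lambda>x. q (f x))"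
proof -
  \<comment> \<open>The two-term recurrence becomes an iteration on pairs of consecutive
    values.\<close>
  have "rec_nat (prod_encode (1, a 1))
      (\<lambda>i r. prod_encode (psnd r, a (Suc (Suc i)) * psnd r + pfst r)) k =
    prod_encode (q k, q (Suc k))" for k by (induction k) auto
  moreover have "recursive (\<lambda>x. pfst (rec_nat (prod_encode (1, a 1))
      (\<lambda>i r. prod_encode (psnd r, a (Suc (Suc i)) * psnd r + pfst r)) (f x)))"
    using assms by (intro recursive_intros)
  ultimately show ?thesis by simp
qed

lemma recursive_p [recursive_intros]:
  assumes "recursive f" shows "recursive (\<lambda>x. p (f x))"
proof -
  have "rec_nat (prod_encode (0, 1))
      (\<lambda>i r. prod_encode (psnd r, a (Suc (Suc i)) * psnd r + pfst r)) k =
    prod_encode (p k, p (Suc k))" for k by (induction k) auto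
  moreover have "recursive (\<lambda>x. pfst (rec_nat (prod_encode (0, 1))
      (\<lambda>i r. prod_encode (psnd r, a (Suc (Suc i)) * psnd r + pfst r)) (f x)))"
    using assms by (intro recursive_intros)
  ultimately show ?thesis by simp
qed

lemma field_recursive_mu [recursive_intros]:
  "recursive f \<Longrightarrow> field_recursive (\<lambda>x. \<mu> (f x))"
  unfolding \<mu>_def by (intro recursive_intros)

lemma decidable_ostrowski_digits [recursive_intros]:
  assumes "recursive c" "recursive L"
  shows "decidable (\<lambda>x. ostrowski_digits (list_nth (c x)) (L x))"
  unfolding ostrowski_digits_def if_bool_eq_conj
  \<comment> \<open>Under a bounded quantifier \<open>c\<close> and \<open>L\<close> are applied to
    a component of the packed environment, which is covered by
    \<open>recursive_comp\<close>.\<close>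
  by (intro recursive_intros assms assms[THEN recursive_comp])

lemma recursive_digit_value [recursive_intros]:
  assumes "recursive c" "recursive L"
  shows "recursive (\<lambda>x. digit_value (list_nth (c x)) (L x))"
  unfolding digit_value_def by (intro recursive_intros assms assms[THEN recursive_comp])

lemma recursive_digit_value_dup [recursive_intros]:
  assumes "recursive c" "recursive L" "recursive i" "recursive j"
  shows "recursive (\<lambda>x. digit_value (dup (i x) (j x) (list_nth (c x))) (L x))"
  unfolding digit_value_def dup_def by (intro recursive_intros assms assms[THEN recursive_comp])

lemma recursive_digit_value_dup_dup [recursive_intros]:
  assumes "recursive c" "recursive L" "recursive i" "recursive j"
  shows "recursive (\<lambda>x. digit_value (dup (i x) (j x) (dup (i x) (j x) (list_nth (c x)))) (L x))"
  unfolding digit_value_def dup_def by (intro recursive_intros assms assms[THEN recursive_comp])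

section \<open>Certificates as natural numbers\<close>

definition coded_run :: "nat \<Rightarrow> (nat \<Rightarrow> nat) \<Rightarrow> (nat \<Rightarrow> nat) \<Rightarrow> (nat \<Rightarrow> nat) \<Rightarrow> nat \<Rightarrow> bool" where
  "coded_run A e f st L \<longleftrightarrow> L > 0 \<and> ostrowski_digits e L \<and> ostrowski_digits f L \<and>
     (e (L - 1) \<noteq> 0 \<or> f (L - 1) \<noteq> 0) \<and> st L = pfst A \<and> list_mem (pfst (psnd A)) (st 0) \<and>
     (\<forall>i<L. list_mem (psnd (psnd A))
        (prod_encode (st (Suc i), prod_encode (prod_encode (e i, f i), st i))))"

lemma coded_run_automaton_code: "coded_run (automaton_code A) e f st L \<longleftrightarrow> run A e f st L"
proof -
  have "inj transition_code" by (auto simp: inj_def transition_code_def)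
  then have "prod_encode (r, prod_encode (prod_encode c, s)) \<in> transition_code ` set (transitions A) \<longleftrightarrow>
      (r, c, s) \<in> set (transitions A)" for r c s
    using inj_image_mem_iff[of transition_code "(r, c, s)"] by (simp add: transition_code_def)
  then show ?thesis
    by (simp add: coded_run_def run_def automaton_code_def list_mem_encode)
qed

definition coded_certificate :: "nat \<Rightarrow> nat \<Rightarrow> real \<Rightarrow> real \<Rightarrow> bool" where
  "coded_certificate A z \<alpha> v \<longleftrightarrow>
     (let e = list_nth (pfst z); f = list_nth (pfst (psnd z)); st = list_nth (pfst (psnd (psnd z)));
        L = pfst (psnd (psnd (psnd z))); i = pfst (psnd (psnd (psnd (psnd z))));
        j = psnd (psnd (psnd (psnd (psnd z))))
      in coded_run A e f st L \<and> pump_equations e f st L i j \<alpha> v)"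

lemma coded_certificate_encode:
  "coded_certificate (automaton_code A)
     (prod_encode (c, prod_encode (d, prod_encode (r, prod_encode (L, prod_encode (i, j)))))) \<alpha> v \<longleftrightarrow>
   run A (list_nth c) (list_nth d) (list_nth r) L \<and>
   pump_equations (list_nth c) (list_nth d) (list_nth r) L i j \<alpha> v"
  by (simp add: coded_certificate_def coded_run_automaton_code Let_def)

lemma decidable_coded_certificate [recursive_intros]:
  assumes "recursive A" "recursive z" "field_recursive \<alpha>" "field_recursive v"
  shows "decidable (\<lambda>x. coded_certificate (A x) (z x) (\<alpha> x) (v x))"
  unfolding coded_certificate_def Let_def coded_run_def pump_equations_def loop_def run_offset_def
  by (intro recursive_intros N_pos assms assms(1,2)[THEN recursive_comp])

text \<open>\<open>c\<close> packs codes of candidates for \<alpha> and \<beta> together with two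
  loops, whose limits are to be \<beta> and \<open>\<beta> - 1\<close>.\<close>

definition solves :: "nat \<Rightarrow> nat \<Rightarrow> bool" where
  "solves A c \<longleftrightarrow>
     (let \<alpha> = lin_comb_decode \<gamma> (pfst (pfst c)); \<beta> = lin_comb_decode \<gamma> (psnd (pfst c)) in
        coded_certificate A (pfst (psnd c)) \<alpha> \<beta> \<and> coded_certificate A (psnd (psnd c)) \<alpha> (\<beta> - 1))"

lemma decidable_solves: "decidable (\<lambda>e. solves (pfst e) (psnd e))"
  unfolding solves_def Let_def by (intro recursive_intros)

text \<open>All limits lie between \<open>\<beta> - 1\<close> and \<beta>. For the candidate
  \<open>y\<close> this gives \<open>y \<le> \<beta>\<close> and
  \<open>\<beta> - 1 \<le> y - 1\<close>, hence equality.\<close>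

lemma solves_sound:
  assumes "synchronizes \<gamma> A (beatty \<alpha> \<beta>)" "solves (automaton_code A) c"
  shows "\<alpha> = lin_comb_decode \<gamma> (pfst (pfst c))" "\<beta> = lin_comb_decode \<gamma> (psnd (pfst c))"
proof -
  define x y where "x = lin_comb_decode \<gamma> (pfst (pfst c))" and "y = lin_comb_decode \<gamma> (psnd (pfst c))"
  have sound: "x = \<alpha> \<and> \<beta> - 1 \<le> v \<and> v \<le> \<beta>"
    if "coded_certificate (automaton_code A) z x v" for z v
  proof -
    note z = that[unfolded coded_certificate_def Let_def coded_run_automaton_code]
    show ?thesis using certificate_sound[OF assms(1) z[THEN conjunct1] z[THEN conjunct2]] by simp
  qed
  then have "x = \<alpha> \<and> y \<le> \<beta> \<and> \<beta> - 1 \<le> y - 1"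
    using assms(2) unfolding solves_def Let_def x_def[symmetric] y_def[symmetric] by blast
  then show "\<alpha> = lin_comb_decode \<gamma> (pfst (pfst c))" "\<beta> = lin_comb_decode \<gamma> (psnd (pfst c))"
    by (auto simp: x_def y_def)
qed

text \<open>Both extremal values are limits of loops, and the equations of these loops show that
  \<alpha> and \<beta> are rational combinations of 1 and \<gamma>, so they have codes.\<close>

lemma solves_complete:
  assumes sync: "synchronizes \<gamma> A (beatty \<alpha> \<beta>)" and irr: "\<alpha> \<notin> \<rat>"
  shows "\<exists>c. solves (automaton_code A) c"
proof -
  have cert: "\<exists>z. coded_certificate (automaton_code A) z \<alpha> v \<and>
      \<alpha> \<in> rational_combinations \<and> v \<in> rational_combinations" if v: "v = \<beta> \<or> v = \<beta> - 1" for v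
  proof -
    obtain c d r L i j where *: "run A (list_nth c) (list_nth d) (list_nth r) L"
      "pump_equations (list_nth c) (list_nth d) (list_nth r) L i j \<alpha> v"
      using certificate_complete[OF sync irr v] by metis
    then show ?thesis using pump_equations_rational[OF *(2)] coded_certificate_encode by blast
  qed
  obtain z where z: "coded_certificate (automaton_code A) z \<alpha> \<beta>"
    and rat: "\<alpha> \<in> rational_combinations" "\<beta> \<in> rational_combinations" using cert[of \<beta>] by auto
  obtain z' where z': "coded_certificate (automaton_code A) z' \<alpha> (\<beta> - 1)" using cert[of "\<beta> - 1"] by auto
  obtain u w where "lin_comb_decode \<gamma> u = \<alpha>" "lin_comb_decode \<gamma> w = \<beta>"
    using rat rational_combinations_decode by metis
  then have "solves (automaton_code A) (prod_encode (prod_encode (u, w), prod_encode (z, z')))"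
    using z z' by (simp add: solves_def)
  then show ?thesis by blast
qed

text \<open>The search terminates by completeness, and by soundness whichever solution it meets
  first carries codes of the true parameters.\<close>

lemma computable_parameters:
  "\<exists>F. partial_recursive F \<and>
    (\<forall>(\<alpha> :: real) (\<beta> :: real) A. \<alpha> \<notin> \<rat> \<and> synchronizes \<gamma> A (beatty \<alpha> \<beta>) \<longrightarrow>
      (\<exists>u v. F (automaton_code A) = Some (prod_encode (u, v)) \<and>
        \<alpha> = lin_comb_decode \<gamma> u \<and> \<beta> = lin_comb_decode \<gamma> v))"
proof -
  have "recursive pfst" by (intro recursive_intros)
  from partial_recursive_search[OF decidable_solves this] obtain F where F: "partial_recursive F"
    "\<And>x c. solves x c \<Longrightarrow> \<exists>c'. solves x c' \<and> F x = Some (pfst c')" by metis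
  have "\<exists>u v. F (automaton_code A) = Some (prod_encode (u, v)) \<and>
      \<alpha> = lin_comb_decode \<gamma> u \<and> \<beta> = lin_comb_decode \<gamma> v"
    if A: "\<alpha> \<notin> \<rat>" "synchronizes \<gamma> A (beatty \<alpha> \<beta>)" for \<alpha> \<beta> A
  proof -
    obtain c where c: "solves (automaton_code A) c" "F (automaton_code A) = Some (pfst c)"
      using solves_complete[OF A(2,1)] F(2) by blast
    have "pfst c = prod_encode (pfst (pfst c), psnd (pfst c))" by (simp add: pfst_def psnd_def)
    then show ?thesis using c solves_sound[OF A(2) c(1)] by metis
  qed
  then show ?thesis using F(1) by blast
qed

end

text \<open>As \<gamma> lies between 0 and 1, its complete quotients from index 1 on are those of
  \<open>1 / \<gamma>\<close>. The period is doubled to make it even.\<close>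

lemma periodic_cf_purely_periodic:
  assumes "0 < \<gamma>" "\<gamma> < 1" "\<gamma> \<notin> \<rat>" "purely_periodic_cf (1 / \<gamma>)"
  obtains N where "periodic_cf \<gamma> N"
proof -
  obtain P where P: "P \<ge> 1" "\<And>n. cf_coeff (1 / \<gamma>) (n + P) = cf_coeff (1 / \<gamma>) n"
    using assms(4) unfolding purely_periodic_cf_def by blast
  have "cf_rem \<gamma> (Suc n) = cf_rem (1 / \<gamma>) n" for n
    using assms(1,2) by (induction n) (auto simp: frac_eq)
  then have d: "cf_digit \<gamma> (Suc n) = nat (cf_coeff (1 / \<gamma>) n)" for n
    by (simp only: cf_digit_def cf_coeff_def)
  have "periodic_cf \<gamma> (2 * P)"
  proof
    show "cf_digit \<gamma> (Suc (i + 2 * P)) = cf_digit \<gamma> (Suc i)" for i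
      using P(2)[of "i + P"] P(2)[of i] unfolding d by (simp add: mult_2 add.assoc)
  qed (use assms P in auto)
  then show ?thesis by (rule that)
qed

theorem theorem28:
  fixes \<gamma> :: real
  assumes "0 < \<gamma>" and "\<gamma> < 1"
    and "quadratic_irrational \<gamma>"
    and "purely_periodic_cf (1 / \<gamma>)"
  shows "(\<forall>\<alpha> \<beta> :: real. \<alpha> \<notin> \<rat> \<and> ostrowski_synchronized \<gamma> (beatty \<alpha> \<beta>) \<longrightarrow>
            \<alpha> \<in> rat_adjoin \<gamma> \<and> \<beta> \<in> rat_adjoin \<gamma>) \<and>
         (\<exists>F :: nat \<Rightarrow> nat option. partial_recursive F \<and>
            (\<forall>(\<alpha> :: real) (\<beta> :: real) A. \<alpha> \<notin> \<rat> \<and> synchronizes \<gamma> A (beatty \<alpha> \<beta>) \<longrightarrow>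
               (\<exists>u v. F (automaton_code A) = Some (prod_encode (u, v)) \<and>
                  \<alpha> = lin_comb_decode \<gamma> u \<and> \<beta> = lin_comb_decode \<gamma> v)))"
proof -
  obtain N where "periodic_cf \<gamma> N"
    using periodic_cf_purely_periodic assms unfolding quadratic_irrational_def by blast
  then obtain F where F: "partial_recursive F"
    "\<And>\<alpha> \<beta> A. \<alpha> \<notin> \<rat> \<Longrightarrow> synchronizes \<gamma> A (beatty \<alpha> \<beta>) \<Longrightarrow>
      \<exists>u v. F (automaton_code A) = Some (prod_encode (u, v)) \<and>
        \<alpha> = lin_comb_decode \<gamma> u \<and> \<beta> = lin_comb_decode \<gamma> v"
    using periodic_cf.computable_parameters by meson
  then have "\<alpha> \<in> rat_adjoin \<gamma> \<and> \<beta> \<in> rat_adjoin \<gamma>"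
    if "\<alpha> \<notin> \<rat>" "ostrowski_synchronized \<gamma> (beatty \<alpha> \<beta>)" for \<alpha> \<beta>
    using that lin_comb_decode_rat_adjoin unfolding ostrowski_synchronized_def by metis
  then show ?thesis using F by blast
qed

end
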